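(* Let $k$ be an integer with $k \ge 2$, and let $G$ be a graph with precisely two connected components, one of which is trivial. Then $G$ is a cograph minimal $(\infty,k)$-polar obstruction if and only if $G \cong K_1 + (K_1 \oplus H')$, where $H'$ is a disconnected cograph minimal $(\infty,k-1)$-polar obstruction that is $(1,k)$-polar.
   Context: All graphs are finite and simple. A cograph is a graph with no induced subgraph isomorphic to $P_4$. $G+H$ denotes disjoint union and $G \oplus H$ the join (disjoint union plus all edges between $G$ and $H$). A component is trivial if it is isomorphic to $K_1$. A cluster is a disjoint union of complete graphs. For $s,k \in \mathbb{Z}_{\ge 0}\cup\{\infty\}$, an $(s,k)$-polar partition of $G$ is a partition $(A,B)$ of $V(G)$ (parts may be empty) such that $G[A]$ is a complete multipartite graph with at most $s$ parts and $G[B]$ is a cluster with at most $k$ components; $\infty$ means unbounded. $G$ is $(s,k)$-polar if it has such a partition. A cograph minimal $(s,k)$-polar obstruction is a cograph that is not $(s,k)$-polar but all of whose proper induced subgraphs are $(s,k)$-polar. *)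

theory Defs
  imports
    "Graph_Theory.Graph_Theory"
    "HOL-Library.Extended_Nat"
    "HOL-Library.Disjoint_Sets"
begin

text \<open>
  A finite simple graph is a \<^locale>\<open>graph\<close>: a finite loopless symmetric digraph
  without parallel arcs, an edge \<open>uv\<close> being the pair of arcs \<open>(u,v)\<close>, \<open>(v,u)\<close>. Graphs built
  explicitly have the type \<^typ>\<open>'a pair_pre_digraph\<close>, for which the corresponding locale is
  \<^locale>\<open>pair_graph\<close>. As arcs are symmetric, the strongly connected components are the
  connected components.
\<close>

abbreviation conn_components :: "('a,'b) pre_digraph \<Rightarrow> ('a,'b) pre_digraph set" where
  "conn_components G \<equiv> pre_digraph.sccs G"

definition singleton_graph :: "unit pair_pre_digraph" where
  "singleton_graph = \<lparr> pverts = {()}, parcs = {} \<rparr>"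

definition path_graph :: "nat \<Rightarrow> nat pair_pre_digraph" where
  "path_graph n = \<lparr> pverts = {..<n}, parcs = {(i,j). i < n \<and> j < n \<and> (j = Suc i \<or> i = Suc j)} \<rparr>"

definition disjoint_union ::
    "'a pair_pre_digraph \<Rightarrow> 'b pair_pre_digraph \<Rightarrow> ('a + 'b) pair_pre_digraph" where
  "disjoint_union G H = \<lparr> pverts = pverts G <+> pverts H,
     parcs = map_prod Inl Inl ` parcs G \<union> map_prod Inr Inr ` parcs H \<rparr>"

definition graph_join ::
    "'a pair_pre_digraph \<Rightarrow> 'b pair_pre_digraph \<Rightarrow> ('a + 'b) pair_pre_digraph" where
  "graph_join G H = \<lparr> pverts = pverts G <+> pverts H,
     parcs = parcs (disjoint_union G H)
       \<union> Inl ` pverts G \<times> Inr ` pverts H \<union> Inr ` pverts H \<times> Inl ` pverts G \<rparr>"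

definition cograph :: "('a,'b) pre_digraph \<Rightarrow> bool" where
  "cograph G \<longleftrightarrow> graph G \<and>
     \<not> (\<exists>H. induced_subgraph H G \<and> digraph_iso H (with_proj (path_graph 4)))"

text \<open>
  The parts of a complete multipartite graph are nonempty, so the graph without vertices has no
  part at all.
\<close>

definition multipartition :: "('a,'b) pre_digraph \<Rightarrow> 'a set set \<Rightarrow> bool" where
  "multipartition G P \<longleftrightarrow> partition_on (verts G) P \<and>
     (\<forall>u \<in> verts G. \<forall>v \<in> verts G. u \<rightarrow>\<^bsub>G\<^esub> v \<longleftrightarrow> \<not> (\<exists>X \<in> P. u \<in> X \<and> v \<in> X))"

definition complete_multipartite_le :: "enat \<Rightarrow> ('a,'b) pre_digraph \<Rightarrow> bool" where
  "complete_multipartite_le s G \<longleftrightarrow> graph G \<and> (\<exists>P. multipartition G P \<and> enat (card P) \<le> s)"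

definition cluster :: "('a,'b) pre_digraph \<Rightarrow> bool" where
  "cluster G \<longleftrightarrow> graph G \<and> (\<forall>C \<in> conn_components G. \<exists>n. complete_digraph n C)"

definition cluster_le :: "enat \<Rightarrow> ('a,'b) pre_digraph \<Rightarrow> bool" where
  "cluster_le k G \<longleftrightarrow> cluster G \<and> enat (card (conn_components G)) \<le> k"

definition polar_partition ::
    "enat \<Rightarrow> enat \<Rightarrow> ('a,'b) pre_digraph \<Rightarrow> 'a set \<Rightarrow> 'a set \<Rightarrow> bool" where
  "polar_partition s k G A B \<longleftrightarrow> A \<union> B = verts G \<and> A \<inter> B = {} \<and>
     complete_multipartite_le s (G \<restriction> A) \<and> cluster_le k (G \<restriction> B)"

definition polar :: "enat \<Rightarrow> enat \<Rightarrow> ('a,'b) pre_digraph \<Rightarrow> bool" where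
  "polar s k G \<longleftrightarrow> (\<exists>A B. polar_partition s k G A B)"

definition cograph_min_polar_obstruction ::
    "enat \<Rightarrow> enat \<Rightarrow> ('a,'b) pre_digraph \<Rightarrow> bool" where
  "cograph_min_polar_obstruction s k G \<longleftrightarrow> cograph G \<and> \<not> polar s k G \<and>
     (\<forall>H. induced_subgraph H G \<and> H \<noteq> G \<longrightarrow> polar s k H)"

lemma pair_graph_singleton: "pair_graph singleton_graph"
  by unfold_locales (auto simp: singleton_graph_def symmetric_def sym_def)

lemma pair_graph_path: "pair_graph (path_graph n)"
proof -
  have "parcs (path_graph n) \<subseteq> {..<n} \<times> {..<n}"
    by (auto simp: path_graph_def)
  then have "finite (parcs (path_graph n))"
    by (rule finite_subset) simp
  then show ?thesis
    by unfold_locales (auto simp: path_graph_def symmetric_def sym_def)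
qed

lemma pair_graph_disjoint_union:
  assumes "pair_graph G" "pair_graph H"
  shows "pair_graph (disjoint_union G H)"
proof -
  interpret G: pair_graph G by fact
  interpret H: pair_graph H by fact
  show ?thesis
    by unfold_locales
      (auto simp: disjoint_union_def symmetric_def intro!: symI
        intro: G.arcs_symmetric H.arcs_symmetric
        dest: G.wellformed' H.wellformed' G.no_loops' H.no_loops')
qed

lemma pair_graph_join:
  assumes "pair_graph G" "pair_graph H"
  shows "pair_graph (graph_join G H)"
proof -
  interpret G: pair_graph G by fact
  interpret H: pair_graph H by fact
  show ?thesis
    by unfold_locales
      (auto simp: graph_join_def disjoint_union_def symmetric_def intro!: symI
        intro: G.arcs_symmetric H.arcs_symmetric
        dest: G.wellformed' H.wellformed' G.no_loops' H.no_loops')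
qed

end

theory Submission
  imports Defs
begin

text \<open>An independent set meets only one side of a join. Hence a join that is \<open>(1,k)\<close>-polar is
  already \<open>(\<infinity>,k-1)\<close>-polar, while \<open>K\<^sub>1 + F\<close> is \<open>(\<infinity>,k)\<close>-polar iff \<open>F\<close> is \<open>(1,k)\<close>-polar or
  \<open>(\<infinity>,k-1)\<close>-polar. If \<open>F\<close> is a join, this means that \<open>K\<^sub>1 + F\<close> is \<open>(\<infinity>,k)\<close>-polar iff \<open>F\<close> is
  \<open>(\<infinity>,k-1)\<close>-polar. In a minimal obstruction \<open>K\<^sub>1 + F\<close> the connected cograph \<open>F\<close> is a join one
  side of which is complete multipartite. That side does not affect \<open>(\<infinity>,k-1)\<close>-polarity, so by
  minimality it is a single vertex. The other side is \<open>H'\<close>: it is \<open>(1,k)\<close>-polar but not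
  \<open>(\<infinity>,k-1)\<close>-polar, so it is not itself a join and is disconnected.\<close>

section \<open>Polarity of symmetric irreflexive relations\<close>

text \<open>For symmetric irreflexive \<open>E\<close> this makes non-adjacency an equivalence
  relation on \<open>A\<close>; the parts are its classes, in any number.\<close>

definition multipartite_on :: "'a rel \<Rightarrow> 'a set \<Rightarrow> bool" where
  "multipartite_on E A \<longleftrightarrow>
     (\<forall>x\<in>A. \<forall>y\<in>A. \<forall>z\<in>A. (x,y) \<notin> E \<longrightarrow> (y,z) \<notin> E \<longrightarrow> (x,z) \<notin> E)"

definition independent_on :: "'a rel \<Rightarrow> 'a set \<Rightarrow> bool" where
  "independent_on E A \<longleftrightarrow> (\<forall>x\<in>A. \<forall>y\<in>A. (x,y) \<notin> E)"

text \<open>\<open>f\<close> numbers the components with values below \<open>k\<close>. It need not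
  attain all of them, which gives "at most \<open>k\<close>".\<close>

definition cluster_on :: "nat \<Rightarrow> 'a rel \<Rightarrow> 'a set \<Rightarrow> bool" where
  "cluster_on k E B \<longleftrightarrow> (\<exists>f :: 'a \<Rightarrow> nat. (\<forall>x\<in>B. f x < k) \<and>
     (\<forall>x\<in>B. \<forall>y\<in>B. x \<noteq> y \<longrightarrow> ((x,y) \<in> E \<longleftrightarrow> f x = f y)))"

definition polar_on :: "nat \<Rightarrow> 'a rel \<Rightarrow> 'a set \<Rightarrow> bool" where
  "polar_on k E V \<longleftrightarrow>
     (\<exists>A B. A \<union> B = V \<and> A \<inter> B = {} \<and> multipartite_on E A \<and> cluster_on k E B)"

text \<open>At most one part: this is \<open>(1,k)\<close>-polarity, while \<open>polar_on\<close>
  is \<open>(\<infinity>,k)\<close>-polarity.\<close>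

definition monopolar_on :: "nat \<Rightarrow> 'a rel \<Rightarrow> 'a set \<Rightarrow> bool" where
  "monopolar_on k E V \<longleftrightarrow>
     (\<exists>A B. A \<union> B = V \<and> A \<inter> B = {} \<and> independent_on E A \<and> cluster_on k E B)"

text \<open>Symmetry and irreflexivity make \<open>a\<close>, \<open>b\<close>, \<open>c\<close>, \<open>d\<close> pairwise distinct.\<close>

definition P4_free_on :: "'a rel \<Rightarrow> 'a set \<Rightarrow> bool" where
  "P4_free_on E V \<longleftrightarrow> \<not> (\<exists>a\<in>V. \<exists>b\<in>V. \<exists>c\<in>V. \<exists>d\<in>V.
     (a,b) \<in> E \<and> (b,c) \<in> E \<and> (c,d) \<in> E \<and> (a,c) \<notin> E \<and> (b,d) \<notin> E \<and> (a,d) \<notin> E)"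

definition obstruction_on :: "nat \<Rightarrow> 'a rel \<Rightarrow> 'a set \<Rightarrow> bool" where
  "obstruction_on k E V \<longleftrightarrow>
     P4_free_on E V \<and> \<not> polar_on k E V \<and> (\<forall>W. W \<subset> V \<longrightarrow> polar_on k E W)"

text \<open>For symmetric \<open>E\<close> such an \<open>X\<close> is a proper nonempty union of
  components: a witness of disconnectedness that does not mention walks.\<close>

definition separates :: "'a rel \<Rightarrow> 'a set \<Rightarrow> 'a set \<Rightarrow> bool" where
  "separates E V X \<longleftrightarrow> X \<subseteq> V \<and> X \<noteq> {} \<and> X \<noteq> V \<and> (\<forall>x\<in>X. \<forall>y\<in>V - X. (x,y) \<notin> E)"

definition joined :: "'a rel \<Rightarrow> 'a set \<Rightarrow> 'a set \<Rightarrow> bool" where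
  "joined E X Y \<longleftrightarrow> X \<noteq> {} \<and> Y \<noteq> {} \<and> X \<inter> Y = {} \<and>
     (\<forall>x\<in>X. \<forall>y\<in>Y. (x,y) \<in> E \<and> (y,x) \<in> E)"

lemma multipartite_on_subset: "multipartite_on E A \<Longrightarrow> A' \<subseteq> A \<Longrightarrow> multipartite_on E A'"
  unfolding multipartite_on_def by blast

lemma independent_on_imp_multipartite_on: "independent_on E A \<Longrightarrow> multipartite_on E A"
  unfolding independent_on_def multipartite_on_def by blast

lemma cluster_onI:
  assumes "\<And>x. x \<in> B \<Longrightarrow> f x < k"
    and "\<And>x y. x \<in> B \<Longrightarrow> y \<in> B \<Longrightarrow> x \<noteq> y \<Longrightarrow> (x,y) \<in> E \<longleftrightarrow> f x = f y"
  shows "cluster_on k E B"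
  using assms unfolding cluster_on_def by blast

lemma cluster_on_subset:
  assumes "cluster_on k E B" and "B' \<subseteq> B"
  shows "cluster_on k E B'"
proof -
  obtain f where "\<forall>x\<in>B. f x < k" "\<forall>x\<in>B. \<forall>y\<in>B. x \<noteq> y \<longrightarrow> ((x,y) \<in> E \<longleftrightarrow> f x = f y)"
    using assms(1) unfolding cluster_on_def by blast
  then show ?thesis using assms(2) by (intro cluster_onI[of _ f]) auto
qed

lemma polar_on_subset:
  assumes "polar_on k E V" and "W \<subseteq> V"
  shows "polar_on k E W"
proof -
  obtain A B where "A \<union> B = V" "A \<inter> B = {}" "multipartite_on E A" "cluster_on k E B"
    using assms(1) unfolding polar_on_def by blast
  then show ?thesis
    unfolding polar_on_def using assms(2)
    by (intro exI[of _ "A \<inter> W"] exI[of _ "B \<inter> W"])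
      (auto intro: multipartite_on_subset cluster_on_subset)
qed

lemma monopolar_on_imp_polar_on: "monopolar_on k E V \<Longrightarrow> polar_on k E V"
  unfolding monopolar_on_def polar_on_def using independent_on_imp_multipartite_on by blast

lemma polar_on_multipartite: "multipartite_on E V \<Longrightarrow> polar_on k E V"
  unfolding polar_on_def cluster_on_def by (intro exI[of _ V] exI[of _ "{}"]) simp

text \<open>Non-adjacent vertices of \<open>X \<union> A\<close> lie on the same side of the join,
  so non-adjacency stays transitive when \<open>X\<close> is added to the multipartite part
  \<open>A\<close> of \<open>Y\<close>. A multipartite side of a join can thus be added at no
  cost.\<close>

lemma polar_on_join:
  assumes "multipartite_on E X" and "polar_on k E Y"
    and adj: "\<And>x y. x \<in> X \<Longrightarrow> y \<in> Y \<Longrightarrow> (x,y) \<in> E \<and> (y,x) \<in> E" and disj: "X \<inter> Y = {}"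
  shows "polar_on k E (X \<union> Y)"
proof -
  obtain A B where AB: "A \<union> B = Y" "A \<inter> B = {}" "multipartite_on E A" "cluster_on k E B"
    using assms(2) unfolding polar_on_def by blast
  have "multipartite_on E (X \<union> A)"
    using assms(1) AB(1,3) adj unfolding multipartite_on_def by (metis UnE UnI1)
  then show ?thesis
    unfolding polar_on_def using AB disj
    by (intro exI[of _ "X \<union> A"] exI[of _ B]) auto
qed

lemma joined_sym: "joined E X Y \<Longrightarrow> joined E Y X"
  unfolding joined_def by blast

section \<open>Invariance under isomorphism\<close>

text \<open>Polarity sees only the adjacency inside \<open>V\<close>. Besides isomorphisms, the case
  \<open>f = id\<close> matters: it replaces \<open>E\<close> by another relation that agrees with
  it on \<open>V\<close>.\<close>

lemma polar_on_image:
  assumes inj: "inj_on f V" and adj: "\<And>x y. x \<in> V \<Longrightarrow> y \<in> V \<Longrightarrow> (f x, f y) \<in> E' \<longleftrightarrow> (x,y) \<in> E"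
  shows "polar_on k E' (f ` V) \<longleftrightarrow> polar_on k E V"
    and "monopolar_on k E' (f ` V) \<longleftrightarrow> monopolar_on k E V"
proof -
  have mult: "multipartite_on E' (f ` A) \<longleftrightarrow> multipartite_on E A" if "A \<subseteq> V" for A
    using that adj unfolding multipartite_on_def by (simp add: subset_iff)
  have ind: "independent_on E' (f ` A) \<longleftrightarrow> independent_on E A" if "A \<subseteq> V" for A
    using that adj unfolding independent_on_def by (simp add: subset_iff)
  have clus: "cluster_on k E' (f ` B) \<longleftrightarrow> cluster_on k E B" if B: "B \<subseteq> V" for B
  proof
    assume "cluster_on k E' (f ` B)"
    then obtain c where c: "\<forall>x\<in>B. c (f x) < k"
      "\<forall>x\<in>B. \<forall>y\<in>B. f x \<noteq> f y \<longrightarrow> ((f x,f y) \<in> E' \<longleftrightarrow> c (f x) = c (f y))"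
      unfolding cluster_on_def by auto
    show "cluster_on k E B"
      unfolding cluster_on_def
    proof (intro exI[of _ "c \<circ> f"] conjI ballI impI)
      fix x y assume "x \<in> B" "y \<in> B" "x \<noteq> y"
      moreover from this have "f x \<noteq> f y" using inj B by (meson inj_onD subsetD)
      ultimately show "(x,y) \<in> E \<longleftrightarrow> (c \<circ> f) x = (c \<circ> f) y"
        using c(2) adj B by (metis comp_apply subsetD)
    qed (use c in auto)
  next
    assume "cluster_on k E B"
    then obtain c where c: "\<forall>x\<in>B. c x < k"
      "\<forall>x\<in>B. \<forall>y\<in>B. x \<noteq> y \<longrightarrow> ((x,y) \<in> E \<longleftrightarrow> c x = c y)"
      unfolding cluster_on_def by auto
    have inv: "the_inv_into V f (f x) = x" if "x \<in> B" for x
      using that B inj by (auto intro: the_inv_into_f_f)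
    show "cluster_on k E' (f ` B)"
      unfolding cluster_on_def
    proof (intro exI[of _ "\<lambda>y. c (the_inv_into V f y)"] conjI ballI impI)
      fix x y assume "x \<in> f ` B" "y \<in> f ` B" "x \<noteq> y"
      then obtain x' y' where "x = f x'" "y = f y'" "x' \<in> B" "y' \<in> B" "x' \<noteq> y'" by blast
      moreover have "(f x', f y') \<in> E' \<longleftrightarrow> (x',y') \<in> E"
        using \<open>x' \<in> B\<close> \<open>y' \<in> B\<close> B by (intro adj) auto
      ultimately show "(x,y) \<in> E' \<longleftrightarrow> c (the_inv_into V f x) = c (the_inv_into V f y)"
        using c(2) by (simp add: inv)
    qed (use c inv in auto)
  qed
  \<comment> \<open>Both claims transport a partition in the same way, so the argument is made once,
    with \<open>P\<close> and \<open>Q\<close> standing for the condition on the first part.\<close>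
  have split: "(\<exists>A B. A \<union> B = f ` V \<and> A \<inter> B = {} \<and> P A \<and> cluster_on k E' B) \<longleftrightarrow>
      (\<exists>A B. A \<union> B = V \<and> A \<inter> B = {} \<and> Q A \<and> cluster_on k E B)"
    if PQ: "\<And>A. A \<subseteq> V \<Longrightarrow> P (f ` A) \<longleftrightarrow> Q A" for P :: "'b set \<Rightarrow> bool" and Q
  proof safe
    fix A B assume AB: "A \<union> B = f ` V" "A \<inter> B = {}" "P A" "cluster_on k E' B"
    have "A \<subseteq> f ` V" "B \<subseteq> f ` V" using AB(1) by blast+
    then have im: "f ` (f -` A \<inter> V) = A" "f ` (f -` B \<inter> V) = B" by blast+
    have "Q (f -` A \<inter> V)" using PQ[of "f -` A \<inter> V"] AB(3) im by simp
    moreover have "cluster_on k E (f -` B \<inter> V)" using clus[of "f -` B \<inter> V"] AB(4) im by simp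
    moreover have "(f -` A \<inter> V) \<union> (f -` B \<inter> V) = V" "(f -` A \<inter> V) \<inter> (f -` B \<inter> V) = {}"
      using AB(1,2) by auto
    ultimately show "\<exists>A B. A \<union> B = V \<and> A \<inter> B = {} \<and> Q A \<and> cluster_on k E B" by blast
  next
    fix A B assume AB: "V = A \<union> B" "A \<inter> B = {}" "Q A" "cluster_on k E B"
    have "P (f ` A)" "cluster_on k E' (f ` B)" using PQ[of A] clus[of B] AB by auto
    moreover have "f ` A \<union> f ` B = f ` (A \<union> B)" by blast
    moreover have "f ` A \<inter> f ` B = {}"
      using inj AB(1,2) by (metis inj_on_image_Int Un_upper1 Un_upper2 image_empty)
    ultimately show "\<exists>A' B'. A' \<union> B' = f ` (A \<union> B) \<and> A' \<inter> B' = {} \<and> P A' \<and> cluster_on k E' B'"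
      by blast
  qed
  show "polar_on k E' (f ` V) \<longleftrightarrow> polar_on k E V"
    unfolding polar_on_def using mult by (rule split)
  show "monopolar_on k E' (f ` V) \<longleftrightarrow> monopolar_on k E V"
    unfolding monopolar_on_def using ind by (rule split)
qed

lemma obstruction_on_image:
  assumes inj: "inj_on f V" and adj: "\<And>x y. x \<in> V \<Longrightarrow> y \<in> V \<Longrightarrow> (f x, f y) \<in> E' \<longleftrightarrow> (x,y) \<in> E"
  shows "obstruction_on k E' (f ` V) \<longleftrightarrow> obstruction_on k E V"
proof -
  have pol: "polar_on k E' (f ` W) \<longleftrightarrow> polar_on k E W" if "W \<subseteq> V" for W
    using that by (intro polar_on_image inj_on_subset[OF inj] adj) auto
  have "(\<forall>W. W \<subset> f ` V \<longrightarrow> polar_on k E' W) \<longleftrightarrow> (\<forall>W. W \<subset> V \<longrightarrow> polar_on k E W)"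
  proof (intro iffI allI impI)
    fix W assume all: "\<forall>W. W \<subset> f ` V \<longrightarrow> polar_on k E' W" and W: "W \<subset> V"
    have "f ` W \<subset> f ` V"
      using inj W by (metis inj_on_image_eq_iff psubsetE psubsetI image_mono order_refl)
    then show "polar_on k E W" using all pol W by blast
  next
    fix W assume all: "\<forall>W. W \<subset> V \<longrightarrow> polar_on k E W" and W: "W \<subset> f ` V"
    then obtain U where "U \<subset> V" "W = f ` U"
      by (metis order.strict_iff_order subset_image_iff)
    then show "polar_on k E' W" using all pol by blast
  qed
  moreover have "P4_free_on E' (f ` V) \<longleftrightarrow> P4_free_on E V"
    unfolding P4_free_on_def by (simp add: adj cong: conj_cong bex_cong)
  ultimately show ?thesis unfolding obstruction_on_def using pol by blast
qed

section \<open>Polarity of joins and of graphs with an isolated vertex\<close>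

locale sym_irrefl =
  fixes E :: "'a rel"
  assumes sym: "(x,y) \<in> E \<Longrightarrow> (y,x) \<in> E"
    and irrefl: "(x,x) \<notin> E"
begin

lemma clique_imp_multipartite_on:
  assumes "\<And>x y. x \<in> A \<Longrightarrow> y \<in> A \<Longrightarrow> x \<noteq> y \<Longrightarrow> (x,y) \<in> E"
  shows "multipartite_on E A"
  using assms unfolding multipartite_on_def by metis

text \<open>The component with the last number \<open>k\<close> is a clique, hence complete
  multipartite with singleton parts. Moved to the other part, it leaves only components numbered
  below \<open>k\<close>.\<close>

lemma polar_on_of_cluster_on:
  assumes "cluster_on (Suc k) E B"
  shows "polar_on k E B"
proof -
  obtain f where f: "\<forall>x\<in>B. f x < Suc k"
      "\<forall>x\<in>B. \<forall>y\<in>B. x \<noteq> y \<longrightarrow> ((x,y) \<in> E \<longleftrightarrow> f x = f y)"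
    using assms unfolding cluster_on_def by blast
  have "multipartite_on E {x\<in>B. f x = k}"
    using f(2) by (intro clique_imp_multipartite_on) auto
  moreover have "cluster_on k E {x\<in>B. f x \<noteq> k}"
    unfolding cluster_on_def using f by (intro exI[of _ f]) (auto simp: less_Suc_eq)
  ultimately show ?thesis
    unfolding polar_on_def by (intro exI[of _ "{x\<in>B. f x = k}"] exI[of _ "{x\<in>B. f x \<noteq> k}"]) auto
qed

text \<open>An independent set lies in one side of a join, so the cluster part contains the other side.
  Either the cluster part is then a clique, or it is exactly that other side.\<close>

lemma polar_on_of_monopolar_on_join:
  assumes J: "joined E X Y" and mono: "monopolar_on (Suc k) E (X \<union> Y)" and k: "k \<ge> 1"
  shows "polar_on k E (X \<union> Y)"
proof -
  obtain A B where AB: "A \<union> B = X \<union> Y" "A \<inter> B = {}" "independent_on E A" "cluster_on (Suc k) E B"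
    using mono unfolding monopolar_on_def by blast
  \<comment> \<open>The two sides of the join are interchangeable; \<open>P\<close> is the one that
    contains \<open>A\<close>.\<close>
  have side: "polar_on k E (P \<union> Q)"
    if PQ: "joined E P Q" and cover: "A \<union> B = P \<union> Q" and AP: "A \<subseteq> P" for P Q
  proof (cases "A = P")
    case True
    then have "B = Q" using cover AB(2) PQ unfolding joined_def by blast
    \<comment> \<open>\<open>Q\<close> is a cluster with possibly one component too many; that
      component becomes multipartite, and the independent side \<open>P\<close> is added to
      it.\<close>
    then have "polar_on k E Q" using AB(4) polar_on_of_cluster_on by blast
    then show ?thesis
      using PQ AB(3) True
      by (intro polar_on_join independent_on_imp_multipartite_on) (auto simp: joined_def)
  next
    case False
    then obtain p where p: "p \<in> P" "p \<in> B" using cover AP by blast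
    obtain q where q: "q \<in> Q" using PQ unfolding joined_def by blast
    have QB: "Q \<subseteq> B" using PQ AP cover unfolding joined_def by blast
    obtain f where "\<forall>x\<in>B. f x < Suc k"
      and f: "\<forall>x\<in>B. \<forall>y\<in>B. x \<noteq> y \<longrightarrow> ((x,y) \<in> E \<longleftrightarrow> f x = f y)"
      using AB(4) unfolding cluster_on_def by blast
    \<comment> \<open>The edges of the join force equal numbers, so \<open>p\<close> and
      \<open>q\<close> tie all of \<open>B\<close> into one component.\<close>
    have fpq: "f x = f y" if "x \<in> P" "x \<in> B" "y \<in> Q" for x y
      using that PQ QB f unfolding joined_def by (metis disjoint_iff subsetD)
    have "f x = f q" if "x \<in> B" for x
    proof (cases "x \<in> P")
      case True
      then show ?thesis using fpq q that by blast
    next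
      case False
      then have "x \<in> Q" using that cover by blast
      then show ?thesis using fpq p q by metis
    qed
    \<comment> \<open>Since \<open>f\<close> is constant on \<open>B\<close>, \<open>B\<close> is a
      clique; the single number 0 is allowed because \<open>k \<ge> 1\<close>.\<close>
    then have "cluster_on k E B"
      using f k by (intro cluster_onI[of _ "\<lambda>_. 0"]) auto
    then show ?thesis
      unfolding polar_on_def using AB(2,3) cover independent_on_imp_multipartite_on
      by (intro exI[of _ A] exI[of _ B]) auto
  qed
  have "A \<subseteq> X \<or> A \<subseteq> Y"
    using AB(1,3) J unfolding joined_def independent_on_def by blast
  then show ?thesis
    using side[OF J] side[OF joined_sym[OF J]] AB(1) by (auto simp: Un_commute)
qed

text \<open>If the cluster part \<open>B\<close> misses a side, that side lies in the multipartite
  part. If \<open>B\<close> meets both sides, the edges of the join make it a single clique, and the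
  same partition would witness \<open>polar_on k\<close>.\<close>

lemma multipartite_on_side_of_join:
  assumes J: "joined E X Y" and pol: "polar_on l E (X \<union> Y)" and npol: "\<not> polar_on k E (X \<union> Y)"
    and k: "k \<ge> 1"
  shows "multipartite_on E X \<or> multipartite_on E Y"
proof -
  obtain A B where AB: "A \<union> B = X \<union> Y" "A \<inter> B = {}" "multipartite_on E A" "cluster_on l E B"
    using pol unfolding polar_on_def by blast
  obtain f where "\<forall>x\<in>B. f x < l"
    and f: "\<forall>x\<in>B. \<forall>y\<in>B. x \<noteq> y \<longrightarrow> ((x,y) \<in> E \<longleftrightarrow> f x = f y)"
    using AB(4) unfolding cluster_on_def by blast
  show ?thesis
  proof (cases "X \<inter> B = {} \<or> Y \<inter> B = {}")
    case True
    then have "X \<subseteq> A \<or> Y \<subseteq> A" using AB(1) by blast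
    then show ?thesis using AB(3) multipartite_on_subset by blast
  next
    case False
    then obtain p q where pq: "p \<in> X" "p \<in> B" "q \<in> Y" "q \<in> B" by blast
    have fpq: "f x = f y" if "x \<in> X" "x \<in> B" "y \<in> Y" "y \<in> B" for x y
      using that J f unfolding joined_def by (metis disjoint_iff)
    have "f x = f q" if "x \<in> B" for x
      using fpq that pq AB(1) by (metis UnCI UnE)
    then have "cluster_on k E B"
      using f k by (intro cluster_onI[of _ "\<lambda>_. 0"]) auto
    then show ?thesis
      using npol AB unfolding polar_on_def by blast
  qed
qed

text \<open>A complete multipartite graph with an isolated vertex has no edges, and in a cluster an
  isolated vertex is a component of its own. The two disjuncts are the cases
  \<open>v \<in> A\<close> and \<open>v \<in> B\<close>.\<close>

lemma polar_on_insert_isolated: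
  assumes v: "v \<notin> W" and iso: "\<And>w. w \<in> W \<Longrightarrow> (v,w) \<notin> E"
  shows "polar_on (Suc k) E (insert v W) \<longleftrightarrow> monopolar_on (Suc k) E W \<or> polar_on k E W"
proof
  assume "polar_on (Suc k) E (insert v W)"
  then obtain A B where AB: "A \<union> B = insert v W" "A \<inter> B = {}" "multipartite_on E A"
      "cluster_on (Suc k) E B"
    unfolding polar_on_def by blast
  have iso': "(w,v) \<notin> E" if "w \<in> W" for w using iso[OF that] sym by blast
  show "monopolar_on (Suc k) E W \<or> polar_on k E W"
  proof (cases "v \<in> A")
    case True
    have AW: "x \<in> W" if "x \<in> A - {v}" for x using that AB(1) by blast
    \<comment> \<open>Non-adjacency passes from \<open>x\<close> to \<open>y\<close> through
      \<open>v\<close>.\<close>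
    have "(x,y) \<notin> E" if "x \<in> A - {v}" "y \<in> A - {v}" for x y
    proof -
      have "(x,v) \<notin> E" "(v,y) \<notin> E" using AW that iso iso' by blast+
      then show ?thesis using AB(3) True that unfolding multipartite_on_def by blast
    qed
    then have "independent_on E (A - {v})" unfolding independent_on_def by blast
    moreover have "(A - {v}) \<union> B = W" using AB(1,2) True v by auto
    ultimately have "monopolar_on (Suc k) E W"
      unfolding monopolar_on_def using AB(2,4) by (intro exI[of _ "A - {v}"] exI[of _ B]) auto
    then show ?thesis ..
  next
    case False
    then have vB: "v \<in> B" using AB(1) by blast
    obtain f where f: "\<forall>x\<in>B. f x < Suc k"
        "\<forall>x\<in>B. \<forall>y\<in>B. x \<noteq> y \<longrightarrow> ((x,y) \<in> E \<longleftrightarrow> f x = f y)"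
      using AB(4) unfolding cluster_on_def by blast
    have ne: "f x \<noteq> f v" if "x \<in> B - {v}" for x
      using that f(2) vB iso' AB(1) by blast
    \<comment> \<open>The number \<open>f v\<close> is free once \<open>v\<close> is gone, so the
      vertices numbered \<open>k\<close> take it over and all numbers fall below
      \<open>k\<close>.\<close>
    have "cluster_on k E (B - {v})"
      unfolding cluster_on_def
    proof (intro exI[of _ "\<lambda>x. if f x = k then f v else f x"] conjI ballI impI)
      fix x assume x: "x \<in> B - {v}"
      then have "f x \<le> k" "f v \<le> k" "f x \<noteq> f v" using f(1) vB ne by (auto simp: less_Suc_eq_le)
      then show "(if f x = k then f v else f x) < k" by auto
    next
      fix x y assume "x \<in> B - {v}" "y \<in> B - {v}" "x \<noteq> y"
      then show "(x,y) \<in> E \<longleftrightarrow> (if f x = k then f v else f x) = (if f y = k then f v else f y)"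
        using f(2) ne[of x] ne[of y] by auto
    qed
    moreover have "A \<union> (B - {v}) = W" using AB(1,2) vB v by auto
    ultimately have "polar_on k E W"
      unfolding polar_on_def using AB(2,3) by (intro exI[of _ A] exI[of _ "B - {v}"]) auto
    then show ?thesis ..
  qed
next
  assume "monopolar_on (Suc k) E W \<or> polar_on k E W"
  then show "polar_on (Suc k) E (insert v W)"
  proof
    assume "monopolar_on (Suc k) E W"
    then obtain A B where AB: "A \<union> B = W" "A \<inter> B = {}" "independent_on E A"
        "cluster_on (Suc k) E B"
      unfolding monopolar_on_def by blast
    have "independent_on E (insert v A)"
      using AB(1,3) iso sym irrefl unfolding independent_on_def by blast
    then show ?thesis
      unfolding polar_on_def using AB v independent_on_imp_multipartite_on
      by (intro exI[of _ "insert v A"] exI[of _ B]) auto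
  next
    assume "polar_on k E W"
    then obtain A B where AB: "A \<union> B = W" "A \<inter> B = {}" "multipartite_on E A" "cluster_on k E B"
      unfolding polar_on_def by blast
    obtain f where f: "\<forall>x\<in>B. f x < k"
        "\<forall>x\<in>B. \<forall>y\<in>B. x \<noteq> y \<longrightarrow> ((x,y) \<in> E \<longleftrightarrow> f x = f y)"
      using AB(4) unfolding cluster_on_def by blast
    have vB: "v \<notin> B" using AB(1) v by blast
    have vE: "(v,x) \<notin> E" "(x,v) \<notin> E" if "x \<in> B" for x using that iso sym AB(1) by blast+
    \<comment> \<open>\<open>v\<close> becomes a component of its own, with the fresh number
      \<open>k\<close>.\<close>
    have "cluster_on (Suc k) E (insert v B)"
      unfolding cluster_on_def
      by (rule exI[of _ "f(v := k)"]) (use f vB vE in \<open>auto simp: less_Suc_eq\<close>)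
    then show ?thesis
      unfolding polar_on_def using AB v by (intro exI[of _ A] exI[of _ "insert v B"]) auto
  qed
qed

section \<open>A cograph or its complement is disconnected\<close>

text \<open>The induction step of the theorem that a cograph or its complement is disconnected, where
  \<open>X\<close> and \<open>Y\<close> separate the graph without \<open>v\<close>. An edge \<open>xy\<close> inside \<open>X\<close> with \<open>x\<close>, but
  not \<open>y\<close>, adjacent to \<open>v\<close> yields the induced path \<open>z, v, x, y\<close>.\<close>

lemma separates_or_P4:
  assumes "P4_free_on E V" and "v \<in> V" and XY: "X \<union> Y = V - {v}" "X \<inter> Y = {}"
    and no: "\<And>x y. x \<in> X \<Longrightarrow> y \<in> Y \<Longrightarrow> (x,y) \<notin> E"
    and z: "z \<in> Y" "(z,v) \<in> E" and w: "w \<in> X" "(w,v) \<notin> E"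
  shows "separates E V {x\<in>X. (x,v) \<notin> E}"
proof (rule ccontr)
  assume "\<not> ?thesis"
  moreover have "{x\<in>X. (x,v) \<notin> E} \<subseteq> V" "{x\<in>X. (x,v) \<notin> E} \<noteq> {}" "{x\<in>X. (x,v) \<notin> E} \<noteq> V"
    using XY assms(2) w by blast+
  ultimately obtain y x where yx: "y \<in> X" "(y,v) \<notin> E" "x \<in> V" "\<not> (x \<in> X \<and> (x,v) \<notin> E)" "(y,x) \<in> E"
    unfolding separates_def by blast
  have "x \<noteq> v" "x \<notin> Y" using yx no by blast+
  then have x: "x \<in> X" "(x,v) \<in> E" using yx XY by blast+
  have "(v,x) \<in> E" "(x,y) \<in> E" "(z,x) \<notin> E" "(v,y) \<notin> E" "(z,y) \<notin> E"
    using x yx no[OF _ z(1)] sym by blast+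
  moreover have "z \<in> V" "x \<in> V" "y \<in> V" using z x yx XY by blast+
  ultimately show False
    using assms(1,2) z(2) unfolding P4_free_on_def by blast
qed

text \<open>A side without neighbours of \<open>v\<close> still separates, and a \<open>v\<close>
  adjacent to everything is joined to the rest. In the mixed cases the non-neighbours of
  \<open>v\<close> on one side separate, by \<open>separates_or_P4\<close>.\<close>

lemma separates_insert:
  assumes P4: "P4_free_on E V" and v: "v \<in> V" and sep: "separates E (V - {v}) X"
  shows "(\<exists>X. separates E V X) \<or> joined E {v} (V - {v})"
proof -
  define Y where "Y = V - {v} - X"
  have XY: "X \<union> Y = V - {v}" "X \<inter> Y = {}" "X \<noteq> {}" "Y \<noteq> {}"
    using sep unfolding separates_def Y_def by blast+
  have no: "(x,y) \<notin> E" "(y,x) \<notin> E" if "x \<in> X" "y \<in> Y" for x y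
    using that sep sym unfolding separates_def Y_def by blast+
  have V_eq: "V = insert v (X \<union> Y)" and vXY: "v \<notin> X" "v \<notin> Y" using XY(1) v by auto
  \<comment> \<open>Outside the first three cases \<open>v\<close> has neighbours in both
    \<open>X\<close> and \<open>Y\<close> and also some non-neighbour; the latter is paired with a
    neighbour on the opposite side.\<close>
  consider (X) "\<forall>x\<in>X. (x,v) \<notin> E" | (Y) "\<forall>y\<in>Y. (y,v) \<notin> E"
    | (all) "\<forall>x\<in>V - {v}. (x,v) \<in> E"
    | (wX) z w where "z \<in> Y" "(z,v) \<in> E" "w \<in> X" "(w,v) \<notin> E"
    | (wY) z w where "z \<in> X" "(z,v) \<in> E" "w \<in> Y" "(w,v) \<notin> E"
    using XY(1) by blast
  then show ?thesis
  proof cases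
    case X
    then have "separates E V X" unfolding separates_def V_eq using XY(2-4) vXY no by auto
    then show ?thesis by blast
  next
    case Y
    then have "separates E V Y" unfolding separates_def V_eq using XY(2-4) vXY no by auto
    then show ?thesis by blast
  next
    case all
    then have "joined E {v} (V - {v})" unfolding joined_def using XY(1,3) sym by auto
    then show ?thesis ..
  next
    case wX
    then have "separates E V {x\<in>X. (x,v) \<notin> E}"
      using XY no by (intro separates_or_P4[OF P4 v, of X Y z w]) auto
    then show ?thesis by blast
  next
    case wY
    then have "separates E V {y\<in>Y. (y,v) \<notin> E}"
      using XY no by (intro separates_or_P4[OF P4 v, of Y X z w]) auto
    then show ?thesis by blast
  qed
qed

end

lemma sym_irrefl_complement: "sym_irrefl E \<Longrightarrow> sym_irrefl {(x,y). x \<noteq> y \<and> (x,y) \<notin> E}"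
  unfolding sym_irrefl_def by auto

text \<open>\<open>P_4\<close> is self-complementary: the complement of the path
  \<open>a, b, c, d\<close> is the path \<open>c, a, d, b\<close>.\<close>

lemma P4_free_on_complement:
  assumes "sym_irrefl E" and "P4_free_on E V"
  shows "P4_free_on {(x,y). x \<noteq> y \<and> (x,y) \<notin> E} V" (is "P4_free_on ?C V")
proof -
  interpret sym_irrefl E by fact
  show ?thesis
    unfolding P4_free_on_def
  proof
    assume "\<exists>a\<in>V. \<exists>b\<in>V. \<exists>c\<in>V. \<exists>d\<in>V. (a,b) \<in> ?C \<and> (b,c) \<in> ?C \<and> (c,d) \<in> ?C \<and>
      (a,c) \<notin> ?C \<and> (b,d) \<notin> ?C \<and> (a,d) \<notin> ?C"
    then obtain a b c d where V: "a \<in> V" "b \<in> V" "c \<in> V" "d \<in> V"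
      and "(a,b) \<in> ?C" "(b,c) \<in> ?C" "(c,d) \<in> ?C" "(a,c) \<notin> ?C" "(b,d) \<notin> ?C" "(a,d) \<notin> ?C"
      by (elim bexE conjE) (rule that)
    then have "(c,a) \<in> E \<and> (a,d) \<in> E \<and> (d,b) \<in> E \<and> (c,d) \<notin> E \<and> (a,b) \<notin> E \<and> (c,b) \<notin> E"
      using sym by (smt (verit) case_prodI mem_Collect_eq case_prodD)
    then show False using assms(2) V unfolding P4_free_on_def by blast
  qed
qed

lemma separates_complement_iff:
  assumes "sym_irrefl E"
  shows "separates {(x,y). x \<noteq> y \<and> (x,y) \<notin> E} V X \<longleftrightarrow> X \<subseteq> V \<and> joined E X (V - X)"
proof -
  interpret sym_irrefl E by fact
  have "V - X \<noteq> {} \<longleftrightarrow> X \<noteq> V" if "X \<subseteq> V" using that by blast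
  moreover have "(\<forall>x\<in>X. \<forall>y\<in>V - X. (x,y) \<notin> {(x,y). x \<noteq> y \<and> (x,y) \<notin> E}) \<longleftrightarrow>
      (\<forall>x\<in>X. \<forall>y\<in>V - X. (x,y) \<in> E \<and> (y,x) \<in> E)"
    using sym by (intro ball_cong refl) auto
  ultimately show ?thesis unfolding separates_def joined_def by auto
qed

text \<open>Induction on the number of vertices: delete \<open>v\<close> and put it back. If the
  rest separates, \<open>separates_insert\<close> applies. If it is a join, it separates in the
  complement, which is \<open>P_4\<close>-free as well and where the two alternatives are
  exchanged.\<close>

theorem P4_free_on_separates_or_joined:
  assumes "sym_irrefl E" and "finite V" and "2 \<le> card V" and "P4_free_on E V"
  shows "\<exists>X\<subseteq>V. separates E V X \<or> joined E X (V - X)"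
  using assms(2-)
proof (induction "card V" arbitrary: V)
  case 0
  then show ?case by simp
next
  case (Suc n)
  interpret sym_irrefl E by fact
  let ?C = "{(x,y). x \<noteq> y \<and> (x,y) \<notin> E}"
  interpret C: sym_irrefl ?C by (rule sym_irrefl_complement) fact
  obtain v where v: "v \<in> V" using Suc.prems(2) by fastforce
  have card: "card (V - {v}) = n" using Suc.hyps(2) Suc.prems(1) v by simp
  have P4: "P4_free_on E (V - {v})" using Suc.prems(3) unfolding P4_free_on_def by blast
  show ?case
  proof (cases "2 \<le> n")
    case True
    then obtain X where X: "X \<subseteq> V - {v}" "separates E (V - {v}) X \<or> joined E X (V - {v} - X)"
      using Suc.hyps(1)[of "V - {v}"] card Suc.prems(1) P4 by auto
    from X(2) show ?thesis
    proof
      assume "separates E (V - {v}) X"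
      from separates_insert[OF Suc.prems(3) v this] show ?thesis
        using v unfolding separates_def by blast
    next
      assume "joined E X (V - {v} - X)"
      then have "separates ?C (V - {v}) X"
        using separates_complement_iff[OF assms(1)] X(1) by blast
      from C.separates_insert[OF P4_free_on_complement[OF assms(1) Suc.prems(3)] v this]
      consider Y where "separates ?C V Y" | "joined ?C {v} (V - {v})" by blast
      then show ?thesis
      proof cases
        case 1
        then show ?thesis using separates_complement_iff[OF assms(1)] by blast
      next
        case 2
        \<comment> \<open>A vertex joined to the rest in the complement is isolated in
          \<open>E\<close>.\<close>
        then have "separates E V {v}" unfolding separates_def joined_def using v by blast
        then show ?thesis using v by blast
      qed
    qed
  next
    case False
    \<comment> \<open>Here \<open>V\<close> has exactly two vertices, and the rest is too small for
      the induction hypothesis.\<close>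
    then have "card (V - {v}) = 1" using card Suc.hyps(2) Suc.prems(2) by linarith
    then obtain u where u: "V - {v} = {u}" by (meson card_1_singletonE)
    show ?thesis
    proof (cases "(v,u) \<in> E")
      case True
      then have "joined E {v} (V - {v})" unfolding joined_def u using sym u by blast
      then show ?thesis using v by blast
    next
      case False
      then have "separates E V {v}" unfolding separates_def u using u v by blast
      then show ?thesis using v by blast
    qed
  qed
qed

section \<open>Minimal obstructions with an isolated vertex\<close>

context sym_irrefl
begin

text \<open>\<open>insert u W\<close> is a join that is not \<open>polar_on k\<close> because
  \<open>W\<close> is not, and hence not \<open>monopolar_on (Suc k)\<close> either; so the isolated
  \<open>v\<close> fits into neither part. After deletion of \<open>u\<close> or \<open>v\<close>
  the monopolarity of \<open>W\<close> suffices, after deletion of a vertex of \<open>W\<close> its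
  minimality does.\<close>

lemma obstruction_on_insert_isolated_universal:
  assumes k: "k \<ge> 1" and W: "obstruction_on k E W" "monopolar_on (Suc k) E W"
    and vu: "v \<notin> W" "u \<notin> W" "v \<noteq> u"
    and iso: "\<And>w. w \<in> insert u W \<Longrightarrow> (v,w) \<notin> E"
    and univ: "\<And>w. w \<in> W \<Longrightarrow> (u,w) \<in> E"
  shows "obstruction_on (Suc k) E (insert v (insert u W))"
proof -
  have univ': "(w,u) \<in> E" if "w \<in> W" for w using that univ sym by blast
  have iso': "(w,v) \<notin> E" if "w \<in> insert u W" for w using that iso sym by blast
  have npol: "\<not> polar_on k E W" using W(1) unfolding obstruction_on_def by blast
  have "multipartite_on E {}" unfolding multipartite_on_def by blast
  then have "W \<noteq> {}" using npol polar_on_multipartite by blast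
  then have J: "joined E {u} W" unfolding joined_def using vu univ univ' by blast
  have mu: "multipartite_on E {u}" unfolding multipartite_on_def using irrefl by blast
  have "\<not> polar_on k E (insert u W)" using npol polar_on_subset by blast
  moreover have "\<not> monopolar_on (Suc k) E (insert u W)"
    using polar_on_of_monopolar_on_join[OF J _ k] calculation by auto
  ultimately have "\<not> polar_on (Suc k) E (insert v (insert u W))"
    using polar_on_insert_isolated[of v "insert u W"] vu iso by blast
  moreover have "P4_free_on E (insert v (insert u W))"
    unfolding P4_free_on_def
  proof clarify
    fix a b c d
    assume V: "a \<in> insert v (insert u W)" "b \<in> insert v (insert u W)"
      "c \<in> insert v (insert u W)" "d \<in> insert v (insert u W)"
    assume e: "(a,b) \<in> E" "(b,c) \<in> E" "(c,d) \<in> E" "(a,c) \<notin> E" "(b,d) \<notin> E" "(a,d) \<notin> E"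
    \<comment> \<open>Every vertex of the path has a neighbour on it, and \<open>v\<close> has
      none.\<close>
    have nv: "a \<noteq> v" "b \<noteq> v" "c \<noteq> v" "d \<noteq> v"
      using V e iso iso' irrefl by (metis insertE)+
    then have V': "a \<in> insert u W" "b \<in> insert u W" "c \<in> insert u W" "d \<in> insert u W"
      using V by blast+
    have ne: "a \<noteq> d" "a \<noteq> c" "b \<noteq> d" using e sym by blast+
    \<comment> \<open>\<open>u\<close> is adjacent to all of \<open>W\<close>, but every vertex of
      an induced \<open>P_4\<close> misses another one.\<close>
    have "a \<noteq> u" "b \<noteq> u" "c \<noteq> u" "d \<noteq> u"
      using V' e ne univ univ' by (metis insertE)+
    then have "a \<in> W" "b \<in> W" "c \<in> W" "d \<in> W" using V' by blast+
    then show False using e W(1) unfolding obstruction_on_def P4_free_on_def by blast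
  qed
  moreover have "polar_on (Suc k) E U" if U: "U \<subset> insert v (insert u W)" for U
  proof -
    \<comment> \<open>Polarity is hereditary, so it suffices to delete a single vertex
      \<open>x\<close>.\<close>
    obtain x where x: "x \<in> insert v (insert u W)" "U \<subseteq> insert v (insert u W) - {x}"
      using U by blast
    have "polar_on (Suc k) E (insert v (insert u W) - {x})"
    proof -
      consider "x = v" | "x = u" | "x \<in> W" using x(1) by blast
      then show ?thesis
      proof cases
        case 1
        have "polar_on (Suc k) E ({u} \<union> W)"
          using mu W(2) monopolar_on_imp_polar_on univ univ' vu by (intro polar_on_join) auto
        then show ?thesis using 1 vu by (simp add: insert_Diff_if)
      next
        case 2
        have "polar_on (Suc k) E (insert v W)"
          using polar_on_insert_isolated[of v W] W(2) vu iso by blast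
        then show ?thesis using 2 vu by (simp add: insert_Diff_if)
      next
        case 3
        then have "polar_on k E (W - {x})" using W(1) unfolding obstruction_on_def by blast
        then have "polar_on k E ({u} \<union> (W - {x}))"
          using mu univ univ' vu by (intro polar_on_join) auto
        then have "polar_on (Suc k) E (insert v ({u} \<union> (W - {x})))"
          using polar_on_insert_isolated[of v "{u} \<union> (W - {x})"] vu iso by blast
        moreover have "insert v (insert u W) - {x} = insert v ({u} \<union> (W - {x}))"
          using 3 vu by blast
        ultimately show ?thesis by simp
      qed
    qed
    then show ?thesis using x(2) polar_on_subset by blast
  qed
  ultimately show ?thesis unfolding obstruction_on_def by blast
qed

text \<open>Supplies the size hypothesis of \<open>P4_free_on_separates_or_joined\<close>; a graph
  with at most one vertex is complete multipartite.\<close>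

lemma card_ge_2_of_not_polar_on:
  assumes "finite V" and "\<not> polar_on k E V"
  shows "2 \<le> card V"
proof (rule ccontr)
  assume "\<not> ?thesis"
  then have "card V \<le> Suc 0" by simp
  then have "\<forall>x\<in>V. \<forall>y\<in>V. x = y" using assms(1) by (simp add: card_le_Suc0_iff_eq)
  then have "multipartite_on E V" unfolding multipartite_on_def using irrefl by metis
  then show False using assms(2) polar_on_multipartite by blast
qed

text \<open>The decomposition opposite to \<open>obstruction_on_insert_isolated_universal\<close>.
  Throughout, \<open>iso\<close> turns polarity of a set containing \<open>v\<close> into a
  statement about the set without \<open>v\<close>.\<close>

lemma obstruction_on_isolatedE:
  assumes fin: "finite V" and k: "k \<ge> 1" and V: "obstruction_on (Suc k) E V"
    and v: "v \<in> V" "\<And>w. w \<in> V \<Longrightarrow> (v,w) \<notin> E"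
    and conn: "\<And>X. \<not> separates E (V - {v}) X"
  obtains u W X where "V = insert v (insert u W)" "v \<notin> W" "u \<notin> W" "v \<noteq> u"
    "\<And>w. w \<in> W \<Longrightarrow> (u,w) \<in> E" "obstruction_on k E W" "monopolar_on (Suc k) E W" "separates E W X"
proof -
  have ax: "sym_irrefl E" by unfold_locales
  have iso: "polar_on (Suc k) E (insert v U) \<longleftrightarrow> monopolar_on (Suc k) E U \<or> polar_on k E U"
    if "U \<subseteq> V - {v}" for U
    using that v(2) by (intro polar_on_insert_isolated) auto
  have Vv: "insert v (V - {v}) = V" using v(1) by blast
  have npol: "\<not> polar_on k E (V - {v})" "\<not> monopolar_on (Suc k) E (V - {v})"
    using iso[of "V - {v}"] V unfolding Vv obstruction_on_def by auto
  have "P4_free_on E (V - {v})" using V unfolding obstruction_on_def P4_free_on_def by blast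
  with P4_free_on_separates_or_joined[OF ax _ card_ge_2_of_not_polar_on[OF _ npol(1)]] fin conn
  obtain X0 where X0: "X0 \<subseteq> V - {v}" "joined E X0 (V - {v} - X0)" by auto
  \<comment> \<open>As a proper subset of the minimal obstruction \<open>V\<close>, the rest is
    polar for \<open>Suc k\<close>. It is not polar for \<open>k\<close>, so one side of the join
    must be multipartite.\<close>
  have "polar_on (Suc k) E (X0 \<union> (V - {v} - X0))"
    using V v(1) X0(1) unfolding obstruction_on_def
    by (metis Diff_partition Diff_subset Diff_insert_absorb insert_Diff mk_disjoint_insert
        psubsetI)
  moreover have "\<not> polar_on k E (X0 \<union> (V - {v} - X0))" using npol(1) X0(1) by (simp add: Un_absorb1)
  ultimately have "multipartite_on E X0 \<or> multipartite_on E (V - {v} - X0)"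
    using multipartite_on_side_of_join[OF X0(2)] k by blast
  then obtain Y W where YW: "joined E Y W" "Y \<union> W = V - {v}" "multipartite_on E Y"
    using X0 joined_sym by (metis Diff_partition Un_commute)
  have adj: "(x,y) \<in> E \<and> (y,x) \<in> E" if "x \<in> Y" "y \<in> W" for x y
    using YW(1) that unfolding joined_def by blast
  have disj: "Y \<inter> W = {}" using YW(1) unfolding joined_def by blast
  have npW: "\<not> polar_on k E W"
  proof
    assume "polar_on k E W"
    then have "polar_on k E (Y \<union> W)" using YW(3) adj disj by (intro polar_on_join) auto
    then show False using npol(1) YW(2) by simp
  qed
  obtain u where u: "u \<in> Y" using YW(1) unfolding joined_def by blast
  \<comment> \<open>For the join \<open>insert u U\<close> both alternatives in \<open>iso\<close>
    amount to \<open>polar_on k\<close>, which \<open>U\<close> inherits; an empty \<open>U\<close>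
    is no side of a join and is treated apart. So the single vertex \<open>u\<close> can stand in
    for all of \<open>Y\<close>.\<close>
  have joinU: "polar_on k E U" if "monopolar_on (Suc k) E (insert u U) \<or> polar_on k E (insert u U)"
    and "U \<subseteq> W" for U
  proof (cases "U = {}")
    case True
    then show ?thesis using polar_on_multipartite[of E "{}"] by (simp add: multipartite_on_def)
  next
    case False
    then have "joined E {u} U" using that(2) YW(1) u unfolding joined_def by blast
    then have "polar_on k E (insert u U)"
      using that(1) polar_on_of_monopolar_on_join[OF _ _ k, of "{u}" U] by auto
    then show ?thesis using polar_on_subset by blast
  qed
  have sub: "insert u W \<subseteq> V - {v}" using YW(2) u by blast
  have "\<not> polar_on (Suc k) E (insert v (insert u W))"
    using iso[OF sub] joinU[of W] npW by blast
  moreover have "insert v (insert u W) \<subseteq> V" using sub v(1) by blast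
  ultimately have V_eq: "V = insert v (insert u W)"
    using V unfolding obstruction_on_def by blast
  have vu: "v \<notin> W" "u \<notin> W" "v \<noteq> u" using sub u disj by blast+
  have mono: "monopolar_on (Suc k) E W"
  proof -
    \<comment> \<open>Deleting \<open>u\<close> leaves a polar set; since \<open>W\<close> is not
      polar for \<open>k\<close>, the other alternative in \<open>iso\<close> must hold.\<close>
    have "insert v W \<subset> V" unfolding V_eq using vu by auto
    then have "polar_on (Suc k) E (insert v W)" using V unfolding obstruction_on_def by blast
    then show ?thesis using iso[of W] sub npW by blast
  qed
  have "polar_on k E U" if "U \<subset> W" for U
  proof -
    have "insert v (insert u U) \<subset> V" unfolding V_eq using vu that by auto
    then have "polar_on (Suc k) E (insert v (insert u U))"
      using V unfolding obstruction_on_def by blast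
    then show ?thesis using iso[of "insert u U"] joinU[of U] sub that by blast
  qed
  moreover have P4: "P4_free_on E W"
    using V YW(2) unfolding obstruction_on_def P4_free_on_def by blast
  ultimately have obs: "obstruction_on k E W" using npW unfolding obstruction_on_def by blast
  \<comment> \<open>If \<open>W\<close> were a join, its monopolarity would make it polar for
    \<open>k\<close>.\<close>
  have "\<not> joined E X (W - X)" if "X \<subseteq> W" for X
  proof
    assume "joined E X (W - X)"
    from polar_on_of_monopolar_on_join[OF this _ k] mono npW that show False
      by (simp add: Un_absorb1)
  qed
  moreover have "finite W" using fin V_eq by simp
  ultimately obtain X where "separates E W X"
    using P4_free_on_separates_or_joined[OF ax _ card_ge_2_of_not_polar_on[OF _ npW] P4] by blast
  then show ?thesis using that V_eq vu adj u obs mono by blast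
qed

end

section \<open>From graphs to relations\<close>

lemma arcs_ends_induce_subgraph:
  "arcs_ends (G \<restriction> A) = {(x,y) \<in> arcs_ends G. x \<in> A \<and> y \<in> A}"
  by (auto simp: arcs_ends_conv)

lemma on_induce_subgraph:
  shows "multipartite_on (arcs_ends (G \<restriction> A)) A \<longleftrightarrow> multipartite_on (arcs_ends G) A"
    and "independent_on (arcs_ends (G \<restriction> A)) A \<longleftrightarrow> independent_on (arcs_ends G) A"
    and "cluster_on k (arcs_ends (G \<restriction> A)) A \<longleftrightarrow> cluster_on k (arcs_ends G) A"
  unfolding multipartite_on_def independent_on_def cluster_on_def arcs_ends_induce_subgraph
  by simp_all

context graph
begin

lemma graph_induced_subgraph:
  assumes "induced_subgraph H G"
  shows "graph H"
proof -
  interpret H: digraph H using assms by (rule digraphI_induced)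
  show ?thesis using induced_graph_imp_symmetric[OF sym_arcs assms] by (rule H.graphI)
qed

text \<open>There are no parallel arcs, so an isomorphism comes down to a bijection of the vertices
  that preserves adjacency in both directions.\<close>

lemma digraph_iso_with_proj_iff:
  assumes "pair_wf_digraph K"
  shows "digraph_iso G (with_proj K) \<longleftrightarrow> (\<exists>f. inj_on f (verts G) \<and> f ` verts G = pverts K \<and>
    (\<forall>x\<in>verts G. \<forall>y\<in>verts G. (f x, f y) \<in> parcs K \<longleftrightarrow> (x,y) \<in> arcs_ends G))"
    (is "?L \<longleftrightarrow> (\<exists>f. ?P f)")
proof
  assume ?L
  then obtain h where h: "digraph_isomorphism h" "with_proj K = app_iso h G"
    unfolding digraph_iso_def by blast
  let ?f = "iso_verts h"
  have V: "pverts K = ?f ` verts G" and A: "parcs K = iso_arcs h ` arcs G"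
    and tl: "iso_tail h = fst" "iso_head h = snd"
    using arg_cong[OF h(2), of verts] arg_cong[OF h(2), of arcs]
      arg_cong[OF h(2), of tail] arg_cong[OF h(2), of head] by simp_all
  have arc: "iso_arcs h e = (?f (tail G e), ?f (head G e))" if "e \<in> arcs G" for e
    using h(1) that unfolding digraph_isomorphism_def tl by (metis prod.collapse)
  have inj: "inj_on ?f (verts G)" using h(1) by (rule digraph_isomorphism_inj_on_verts)
  have "(?f x, ?f y) \<in> parcs K \<longleftrightarrow> (x,y) \<in> arcs_ends G" if "x \<in> verts G" "y \<in> verts G" for x y
    unfolding A arcs_ends_conv using inj_on_eq_iff[OF inj] that
    by (auto simp: arc image_iff)
  then show "\<exists>f. ?P f" using V inj by (intro exI[of _ ?f]) simp
next
  assume "\<exists>f. ?P f"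
  then obtain f where inj: "inj_on f (verts G)" and V: "f ` verts G = pverts K"
    and E: "\<And>x y. x \<in> verts G \<Longrightarrow> y \<in> verts G \<Longrightarrow> (f x, f y) \<in> parcs K \<longleftrightarrow> (x,y) \<in> arcs_ends G"
    by blast
  \<comment> \<open>The arc map is forced by the vertex map, as an arc of \<open>with_proj K\<close>
    is the pair of its ends.\<close>
  define h where "h = \<lparr>iso_verts = f, iso_arcs = (\<lambda>e. (f (tail G e), f (head G e))),
    iso_head = snd, iso_tail = fst\<rparr>"
  have "inj_on (\<lambda>e. (f (tail G e), f (head G e))) (arcs G)"
  proof (rule inj_onI)
    fix e e' assume e: "e \<in> arcs G" "e' \<in> arcs G"
      and "(f (tail G e), f (head G e)) = (f (tail G e'), f (head G e'))"
    then have "arc_to_ends G e = arc_to_ends G e'"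
      unfolding arc_to_ends_def using inj_onD[OF inj] by (auto simp: wellformed)
    then show "e = e'" using e by (intro no_multi_arcs)
  qed
  then have "digraph_isomorphism h"
    unfolding digraph_isomorphism_def h_def using inj wf_digraph by simp
  moreover have "parcs K = (\<lambda>e. (f (tail G e), f (head G e))) ` arcs G"
  proof safe
    fix a b assume ab: "(a,b) \<in> parcs K"
    then have "a \<in> f ` verts G" "b \<in> f ` verts G"
        unfolding V by (auto dest: pair_wf_digraph.wellformed'[OF assms])
    then obtain x y where xy: "x \<in> verts G" "y \<in> verts G" "a = f x" "b = f y" by blast
    then have "(x,y) \<in> arcs_ends G" using E ab by blast
    then show "(a,b) \<in> (\<lambda>e. (f (tail G e), f (head G e))) ` arcs G"
      unfolding arcs_ends_conv xy by auto
  next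
    fix e assume "e \<in> arcs G"
    then show "(f (tail G e), f (head G e)) \<in> parcs K"
      by (subst E) (auto simp: arcs_ends_conv)
  qed
  then have "with_proj K = app_iso h G"
    unfolding h_def app_iso_def with_proj_def by (simp add: V)
  ultimately show ?L unfolding digraph_iso_def by blast
qed

lemma complete_multipartite_le_infinity_iff:
  shows "complete_multipartite_le \<infinity> G \<longleftrightarrow> multipartite_on (arcs_ends G) (verts G)"
proof
  assume "complete_multipartite_le \<infinity> G"
  then obtain P where P: "partition_on (verts G) P"
    and E: "\<And>u v. u \<in> verts G \<Longrightarrow> v \<in> verts G \<Longrightarrow>
      (u,v) \<in> arcs_ends G \<longleftrightarrow> \<not> (\<exists>X\<in>P. u \<in> X \<and> v \<in> X)"
    unfolding complete_multipartite_le_def multipartition_def by blast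
  show "multipartite_on (arcs_ends G) (verts G)"
    unfolding multipartite_on_def
  proof (intro ballI impI)
    fix x y z assume V: "x \<in> verts G" "y \<in> verts G" "z \<in> verts G"
      and "(x,y) \<notin> arcs_ends G" "(y,z) \<notin> arcs_ends G"
    then obtain X Y where XY: "X \<in> P" "x \<in> X" "y \<in> X" "Y \<in> P" "y \<in> Y" "z \<in> Y"
      using E[of x y] E[of y z] by auto
    then have "X = Y"
      using partition_onD2[OF P] unfolding disjoint_def by (metis IntI empty_iff)
    then show "(x,z) \<notin> arcs_ends G" using E[of x z] V XY by auto
  qed
next
  assume mult: "multipartite_on (arcs_ends G) (verts G)"
  \<comment> \<open>Non-adjacency, which is reflexive as there are no loops; its classes will be the
    parts.\<close>
  define r where "r = {(x,y). x \<in> verts G \<and> y \<in> verts G \<and> (x,y) \<notin> arcs_ends G}"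
  have eq: "equiv (verts G) r"
  proof (rule equivI)
    show "refl_on (verts G) r" "r \<subseteq> verts G \<times> verts G"
      unfolding refl_on_def r_def by (auto dest: adj_not_same)
    show "sym r" unfolding sym_def r_def using graph_symmetric by blast
    show "trans r"
      unfolding trans_def r_def using mult unfolding multipartite_on_def by blast
  qed
  have "(u,v) \<in> arcs_ends G \<longleftrightarrow> \<not> (\<exists>X\<in>verts G // r. u \<in> X \<and> v \<in> X)"
    if V: "u \<in> verts G" "v \<in> verts G" for u v
  proof -
    have "(u,v) \<in> r" if "X \<in> verts G // r" "u \<in> X" "v \<in> X" for X
      using quotient_eq_iff[OF eq that(1,1,2,3)] by simp
    moreover have "r `` {u} \<in> verts G // r" "u \<in> r `` {u}"
      using V(1) quotientI equiv_class_self[OF eq] by fast+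
    ultimately have "(\<exists>X\<in>verts G // r. u \<in> X \<and> v \<in> X) \<longleftrightarrow> (u,v) \<in> r" by blast
    then show ?thesis using V by (simp add: r_def)
  qed
  moreover have "partition_on (verts G) (verts G // r)" using eq by (rule partition_on_quotient)
  ultimately have "multipartition G (verts G // r)" unfolding multipartition_def by blast
  then show "complete_multipartite_le \<infinity> G"
    unfolding complete_multipartite_le_def using graph_axioms by auto
qed

lemma complete_multipartite_le_1_iff:
  shows "complete_multipartite_le 1 G \<longleftrightarrow> independent_on (arcs_ends G) (verts G)"
proof
  assume "complete_multipartite_le 1 G"
  then obtain P where P: "partition_on (verts G) P" "card P \<le> 1"
    and E: "\<And>u v. u \<in> verts G \<Longrightarrow> v \<in> verts G \<Longrightarrow>
      (u,v) \<in> arcs_ends G \<longleftrightarrow> \<not> (\<exists>X\<in>P. u \<in> X \<and> v \<in> X)"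
    unfolding complete_multipartite_le_def multipartition_def by (auto simp: one_enat_def)
  \<comment> \<open>\<open>card\<close> is 0 on infinite sets, so \<open>card P \<le> 1\<close>
    bounds the number of parts only once \<open>P\<close> is finite.\<close>
  have "finite P" using finite_elements[OF finite_verts P(1)] .
  then have "X = Y" if "X \<in> P" "Y \<in> P" for X Y
    using P(2) that card_le_Suc0_iff_eq[of P] by auto
  then show "independent_on (arcs_ends G) (verts G)"
    unfolding independent_on_def using E partition_onD1[OF P(1)] by (metis UnionE)
next
  assume ind: "independent_on (arcs_ends G) (verts G)"
  \<comment> \<open>Parts are nonempty, so the graph without vertices gets the partition without
    parts.\<close>
  define P where "P = (if verts G = {} then {} else {verts G})"
  have "multipartition G P"
    unfolding multipartition_def P_def
    using ind by (auto simp: partition_on_def independent_on_def)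
  moreover have "enat (card P) \<le> 1" unfolding P_def by (simp add: one_enat_def)
  ultimately show "complete_multipartite_le 1 G"
    unfolding complete_multipartite_le_def using graph_axioms by blast
qed

text \<open>An injective numbering of the components yields the required \<open>f\<close>;
  conversely the components are the nonempty classes of vertices with equal number.\<close>

lemma cluster_le_iff:
  shows "cluster_le (enat k) G \<longleftrightarrow> cluster_on k (arcs_ends G) (verts G)"
proof
  have sc_eq: "scc_of x = scc_of y" if "(x,y) \<in> arcs_ends G" for x y
    using that by (intro scc_of_eq scc_ofI_reachable reachable_adjI)
  assume "cluster_le (enat k) G"
  then have comp: "\<And>C. C \<in> sccs \<Longrightarrow> \<exists>n. complete_digraph n C" and "card sccs \<le> k"
    unfolding cluster_le_def cluster_def by auto
  then have "card sccs_verts \<le> card {..<k}" using card_sccs_verts by simp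
  then obtain g where g: "inj_on g sccs_verts" "g ` sccs_verts \<subseteq> {..<k}"
    using card_le_inj[OF finite_sccs_verts, of "{..<k}"] by auto
  show "cluster_on k (arcs_ends G) (verts G)"
  proof (rule cluster_onI[of _ "g \<circ> scc_of"])
    show "(g \<circ> scc_of) x < k" if "x \<in> verts G" for x
      using g(2) scc_of_in_sccs_verts[OF that] by auto
  next
    fix x y assume V: "x \<in> verts G" "y \<in> verts G" "x \<noteq> y"
    show "(x,y) \<in> arcs_ends G \<longleftrightarrow> (g \<circ> scc_of) x = (g \<circ> scc_of) y"
    proof
      assume "(g \<circ> scc_of) x = (g \<circ> scc_of) y"
      then have eq: "scc_of x = scc_of y"
        using inj_onD[OF g(1)] V scc_of_in_sccs_verts by simp
      have "G \<restriction> scc_of x \<in> sccs"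
        using in_verts_sccsD_sccs[OF scc_of_in_sccs_verts[OF V(1)]] .
      then have "arcs_ends (G \<restriction> scc_of x) = {(u,v). (u,v) \<in> scc_of x \<times> scc_of x \<and> u \<noteq> v}"
        using comp unfolding complete_digraph_def by fastforce
      moreover have "x \<in> scc_of x" "y \<in> scc_of x" using V in_scc_of_self eq by auto
      ultimately show "(x,y) \<in> arcs_ends G"
        using V(3) unfolding arcs_ends_induce_subgraph by blast
    qed (simp add: sc_eq)
  qed
next
  assume "cluster_on k (arcs_ends G) (verts G)"
  then obtain f where f: "\<And>x. x \<in> verts G \<Longrightarrow> f x < k"
    "\<And>x y. x \<in> verts G \<Longrightarrow> y \<in> verts G \<Longrightarrow> x \<noteq> y \<Longrightarrow> (x,y) \<in> arcs_ends G \<longleftrightarrow> f x = f y"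
    unfolding cluster_on_def by blast
  \<comment> \<open>Adjacent vertices share a number, so the number is constant along walks.\<close>
  have f_eq: "f u = f v" if "u \<rightarrow>\<^sup>* v" for u v
    using that
  proof (induction rule: reachable_induct)
    case (step v w)
    then show ?case using f(2) adj_not_same by (metis adj_in_verts)
  qed simp
  have scc: "scc_of u = {v \<in> verts G. f v = f u}" if "u \<in> verts G" for u
  proof safe
    fix v assume "v \<in> scc_of u"
    then have "u \<rightarrow>\<^sup>* v" unfolding scc_of_def by simp
    then show "v \<in> verts G" "f v = f u" using f_eq reachable_in_verts by metis+
  next
    fix v assume "v \<in> verts G" "f v = f u"
    then show "v \<in> scc_of u"
      using f(2)[OF that, of v] in_scc_of_self that
      by (cases "v = u") (auto intro: scc_ofI_reachable')
  qed
  have "sccs_verts \<subseteq> (\<lambda>i. {v \<in> verts G. f v = i}) ` {..<k}"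
    unfolding sccs_verts_conv_scc_of using scc f(1) by auto
  then have "card sccs_verts \<le> k" using surj_card_le[of "{..<k}"] by simp
  moreover have "\<exists>n. complete_digraph n C" if "C \<in> sccs" for C
  proof -
    have "C \<in> induce_subgraph G ` scc_of ` verts G"
      using that unfolding sccs_conv_sccs_verts sccs_verts_conv_scc_of .
    then obtain u where u: "u \<in> verts G" "C = G \<restriction> scc_of u" by blast
    have "graph C" using in_sccs_imp_induced[OF that] by (rule graph_induced_subgraph)
    moreover have "arcs_ends C = {(x,y). (x,y) \<in> verts C \<times> verts C \<and> x \<noteq> y}"
      unfolding u(2) arcs_ends_induce_subgraph using f(2) scc[OF u(1)] adj_not_same by auto
    ultimately show ?thesis unfolding complete_digraph_def by blast
  qed
  ultimately show "cluster_le (enat k) G"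
    unfolding cluster_le_def cluster_def using graph_axioms card_sccs_verts by simp
qed

lemma induced_subgraph_iff: "induced_subgraph H G \<longleftrightarrow> (\<exists>W\<subseteq>verts G. H = G \<restriction> W)"
  using induce_eq_iff_induced[of H] induced_induce
  by (metis induced_imp_subgraph subgraph_imp_subverts)

lemma polar_partition_iff:
  "polar_partition \<infinity> (enat k) G A B \<longleftrightarrow> A \<union> B = verts G \<and> A \<inter> B = {} \<and>
     multipartite_on (arcs_ends G) A \<and> cluster_on k (arcs_ends G) B"
  "polar_partition 1 (enat k) G A B \<longleftrightarrow> A \<union> B = verts G \<and> A \<inter> B = {} \<and>
     independent_on (arcs_ends G) A \<and> cluster_on k (arcs_ends G) B"
proof -
  have gr: "graph (G \<restriction> A)" if "A \<subseteq> verts G" for A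
    using that by (intro graph_induced_subgraph induced_induce)
  have "complete_multipartite_le \<infinity> (G \<restriction> A) \<longleftrightarrow> multipartite_on (arcs_ends G) A"
    "complete_multipartite_le 1 (G \<restriction> A) \<longleftrightarrow> independent_on (arcs_ends G) A"
    "cluster_le (enat k) (G \<restriction> A) \<longleftrightarrow> cluster_on k (arcs_ends G) A" if "A \<subseteq> verts G" for A
    using graph.complete_multipartite_le_infinity_iff[OF gr[OF that]]
      graph.complete_multipartite_le_1_iff[OF gr[OF that]] graph.cluster_le_iff[OF gr[OF that]]
    by (simp_all add: on_induce_subgraph)
  moreover have "A \<union> B = verts G \<Longrightarrow> A \<subseteq> verts G \<and> B \<subseteq> verts G" by blast
  ultimately show
    "polar_partition \<infinity> (enat k) G A B \<longleftrightarrow> A \<union> B = verts G \<and> A \<inter> B = {} \<and>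
       multipartite_on (arcs_ends G) A \<and> cluster_on k (arcs_ends G) B"
    "polar_partition 1 (enat k) G A B \<longleftrightarrow> A \<union> B = verts G \<and> A \<inter> B = {} \<and>
       independent_on (arcs_ends G) A \<and> cluster_on k (arcs_ends G) B"
    unfolding polar_partition_def by metis+
qed

lemma polar_iff:
  "polar \<infinity> (enat k) G \<longleftrightarrow> polar_on k (arcs_ends G) (verts G)"
  "polar 1 (enat k) G \<longleftrightarrow> monopolar_on k (arcs_ends G) (verts G)"
  unfolding polar_def polar_on_def monopolar_on_def polar_partition_iff by simp_all

section \<open>Cographs and minimal obstructions\<close>

lemma cograph_iff: "cograph G \<longleftrightarrow> P4_free_on (arcs_ends G) (verts G)"
proof -
  let ?E = "arcs_ends G"
  have path: "pair_wf_digraph (path_graph 4)"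
    using pair_graph_path[of 4] by (simp add: pair_graph_def pair_digraph_def pair_fin_digraph_def)
  have iso: "digraph_iso (G \<restriction> W) (with_proj (path_graph 4)) \<longleftrightarrow>
      (\<exists>f. inj_on f W \<and> f ` W = {..<4} \<and>
        (\<forall>x\<in>W. \<forall>y\<in>W. f y = Suc (f x) \<or> f x = Suc (f y) \<longleftrightarrow> (x,y) \<in> ?E))"
    (is "_ \<longleftrightarrow> (\<exists>f. ?Q f)") if "W \<subseteq> verts G" for W
  proof -
    have "graph (G \<restriction> W)" using that by (intro graph_induced_subgraph induced_induce)
    from graph.digraph_iso_with_proj_iff[OF this path]
    have "digraph_iso (G \<restriction> W) (with_proj (path_graph 4)) \<longleftrightarrow> (\<exists>f. inj_on f W \<and> f ` W = {..<4} \<and>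
        (\<forall>x\<in>W. \<forall>y\<in>W. f x < 4 \<and> f y < 4 \<and> (f y = Suc (f x) \<or> f x = Suc (f y)) \<longleftrightarrow> (x,y) \<in> ?E))"
      (is "_ \<longleftrightarrow> (\<exists>f. ?R f)")
      by (simp add: path_graph_def arcs_ends_induce_subgraph)
    \<comment> \<open>The bound in \<open>path_graph\<close> holds for all values of a map onto
      \<open>{..<4}\<close>.\<close>
    moreover have "?R f \<longleftrightarrow> ?Q f" for f
    proof (intro conj_cong refl)
      assume "f ` W = {..<4}"
      then have "f x < 4" if "x \<in> W" for x using that by blast
      then show "(\<forall>x\<in>W. \<forall>y\<in>W. f x < 4 \<and> f y < 4 \<and> (f y = Suc (f x) \<or> f x = Suc (f y)) \<longleftrightarrow> (x,y) \<in> ?E)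
          \<longleftrightarrow> (\<forall>x\<in>W. \<forall>y\<in>W. f y = Suc (f x) \<or> f x = Suc (f y) \<longleftrightarrow> (x,y) \<in> ?E)"
        by simp
    qed
    ultimately show ?thesis by simp
  qed
  have "(\<exists>H. induced_subgraph H G \<and> digraph_iso H (with_proj (path_graph 4))) \<longleftrightarrow>
      \<not> P4_free_on ?E (verts G)"
  proof
    assume "\<exists>H. induced_subgraph H G \<and> digraph_iso H (with_proj (path_graph 4))"
    then obtain W where W: "W \<subseteq> verts G" "digraph_iso (G \<restriction> W) (with_proj (path_graph 4))"
      unfolding induced_subgraph_iff by blast
    from W(2) obtain f where f: "f ` W = {..<4}"
      "\<forall>x\<in>W. \<forall>y\<in>W. f y = Suc (f x) \<or> f x = Suc (f y) \<longleftrightarrow> (x,y) \<in> ?E"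
      unfolding iso[OF W(1)] by (elim exE conjE)
    have "\<exists>x\<in>W. f x = i" if "i < 4" for i
      using that f(1) by (metis imageE lessThan_iff)
    from this[of 0] this[of 1] this[of 2] this[of 3]
    obtain a b c d where abcd: "a \<in> W" "b \<in> W" "c \<in> W" "d \<in> W"
      "f a = 0" "f b = 1" "f c = 2" "f d = 3" by auto
    then have "(a,b) \<in> ?E" "(b,c) \<in> ?E" "(c,d) \<in> ?E" "(a,c) \<notin> ?E" "(b,d) \<notin> ?E" "(a,d) \<notin> ?E"
      using f(2)[rule_format, of a b] f(2)[rule_format, of b c] f(2)[rule_format, of c d]
        f(2)[rule_format, of a c] f(2)[rule_format, of b d] f(2)[rule_format, of a d] by simp_all
    then show "\<not> P4_free_on ?E (verts G)"
      unfolding P4_free_on_def not_not using abcd(1-4) W(1)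
      by (intro bexI[of _ a] bexI[of _ b] bexI[of _ c] bexI[of _ d]) auto
  next
    assume "\<not> P4_free_on ?E (verts G)"
    then obtain a b c d where V: "a \<in> verts G" "b \<in> verts G" "c \<in> verts G" "d \<in> verts G"
      and e: "(a,b) \<in> ?E" "(b,c) \<in> ?E" "(c,d) \<in> ?E" and n: "(a,c) \<notin> ?E" "(b,d) \<notin> ?E" "(a,d) \<notin> ?E"
      unfolding P4_free_on_def not_not by (elim bexE conjE)
    have ir: "(x,x) \<notin> ?E" for x using adj_not_same by blast
    have e': "(b,a) \<in> ?E" "(c,b) \<in> ?E" "(d,c) \<in> ?E" and n': "(c,a) \<notin> ?E" "(d,b) \<notin> ?E" "(d,a) \<notin> ?E"
      using e n graph_symmetric by blast+
    have ne: "a \<noteq> b" "a \<noteq> c" "a \<noteq> d" "b \<noteq> c" "b \<noteq> d" "c \<noteq> d" using e n e' n' ir by auto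
    \<comment> \<open>The position on the path \<open>a, b, c, d\<close>; the default 3 is the
      position of \<open>d\<close>.\<close>
    define f :: "'a \<Rightarrow> nat" where
      "f x = (if x = a then 0 else if x = b then 1 else if x = c then 2 else 3)" for x
    have fv: "f a = 0" "f b = 1" "f c = 2" "f d = 3" unfolding f_def using ne by simp_all
    have "inj_on f {a,b,c,d}" by (auto simp: inj_on_def fv)
    moreover have "f ` {a,b,c,d} = {..<4}" by (auto simp: fv)
    moreover have "\<forall>x\<in>{a,b,c,d}. \<forall>y\<in>{a,b,c,d}. f y = Suc (f x) \<or> f x = Suc (f y) \<longleftrightarrow> (x,y) \<in> ?E"
      by (simp add: fv e n e' n' ir)
    moreover have abcd: "{a,b,c,d} \<subseteq> verts G" using V by simp
    ultimately have "digraph_iso (G \<restriction> {a,b,c,d}) (with_proj (path_graph 4))"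
      unfolding iso[OF abcd] by (intro exI conjI)
    then show "\<exists>H. induced_subgraph H G \<and> digraph_iso H (with_proj (path_graph 4))"
      unfolding induced_subgraph_iff using abcd by blast
  qed
  then show ?thesis unfolding cograph_def using graph_axioms by blast
qed

lemma cograph_min_polar_obstruction_iff:
  "cograph_min_polar_obstruction \<infinity> (enat k) G \<longleftrightarrow> obstruction_on k (arcs_ends G) (verts G)"
proof -
  have pol: "polar \<infinity> (enat k) (G \<restriction> W) \<longleftrightarrow> polar_on k (arcs_ends G) W" if "W \<subseteq> verts G" for W
  proof -
    have "graph (G \<restriction> W)" using that by (intro graph_induced_subgraph induced_induce)
    from graph.polar_iff(1)[OF this] show ?thesis
      using polar_on_image(1)[of id W "arcs_ends (G \<restriction> W)" "arcs_ends G"]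
      by (simp add: arcs_ends_induce_subgraph)
  qed
  have "G \<restriction> verts G = G" using induce_eq_iff_induced[OF induced_subgraph_refl] .
  then have "(\<forall>H. induced_subgraph H G \<and> H \<noteq> G \<longrightarrow> polar \<infinity> (enat k) H) \<longleftrightarrow>
      (\<forall>W. W \<subset> verts G \<longrightarrow> polar_on k (arcs_ends G) W)"
    unfolding induced_subgraph_iff using pol by (metis induce_subgraph_verts psubset_eq)
  then show ?thesis
    unfolding cograph_min_polar_obstruction_def obstruction_on_def cograph_iff polar_iff by simp
qed

lemma sym_irrefl_arcs_ends: "sym_irrefl (arcs_ends G)"
  using graph_symmetric adj_not_same by unfold_locales blast+

section \<open>Connectedness and components\<close>

text \<open>A walk inside \<open>S\<close> that starts in a separating \<open>X\<close> never leaves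
  it.\<close>

lemma not_separates_strongly_connected:
  assumes "strongly_connected (G \<restriction> S)"
  shows "\<not> separates (arcs_ends G) S X"
proof
  assume sep: "separates (arcs_ends G) S X"
  then obtain x y where xy: "x \<in> X" "y \<in> S - X" unfolding separates_def by blast
  interpret S: wf_digraph "G \<restriction> S" ..
  have XS: "X \<subseteq> S" using sep unfolding separates_def by blast
  have "x \<rightarrow>\<^sup>*\<^bsub>G \<restriction> S\<^esub> y" using assms xy XS by (auto simp: strongly_connected_def)
  then have "y \<in> X"
  proof (induction rule: S.reachable_induct)
    case base
    show ?case by (rule xy(1))
  next
    case (step y z)
    then show ?case
      using sep unfolding separates_def by (auto simp: arcs_ends_induce_subgraph)
  qed
  then show False using xy(2) by blast
qed

lemma not_connected_iff:
  assumes "verts G \<noteq> {}"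
  shows "\<not> Digraph_Component.connected G \<longleftrightarrow> (\<exists>X. separates (arcs_ends G) (verts G) X)"
proof
  assume "\<not> Digraph_Component.connected G"
  then obtain u v where uv: "u \<in> verts G" "v \<in> verts G" "\<not> u \<rightarrow>\<^sup>*\<^bsub>mk_symmetric G\<^esub> v"
    using connectedI assms by blast
  then have "\<not> u \<rightarrow>\<^sup>* v" using reachable_mk_symmetricI by blast
  \<comment> \<open>The set of vertices reachable from \<open>u\<close> is closed under adjacency
    and misses \<open>v\<close>.\<close>
  then have "separates (arcs_ends G) (verts G) {w. u \<rightarrow>\<^sup>* w}"
    unfolding separates_def using uv by (auto dest: reachable_in_verts intro: reachable_adj_trans)
  then show "\<exists>X. separates (arcs_ends G) (verts G) X" ..
next
  assume sep: "\<exists>X. separates (arcs_ends G) (verts G) X"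
  show "\<not> Digraph_Component.connected G"
  proof
    assume "Digraph_Component.connected G"
    then have "strongly_connected (G \<restriction> verts G)"
      using symmetric_connected_imp_strongly_connected[OF sym_arcs]
        induce_eq_iff_induced[OF induced_subgraph_refl] by simp
    then show False using sep not_separates_strongly_connected by blast
  qed
qed

text \<open>The trivial component is some \<open>{v}\<close>. As there are only two components, the
  other one is \<open>verts G - {v}\<close>, which is therefore strongly connected and not
  separated.\<close>

lemma isolated_vertex_of_components:
  assumes "card sccs = 2" and "C \<in> sccs" and "complete_digraph 1 C"
  obtains v where "v \<in> verts G" "\<And>w. w \<in> verts G \<Longrightarrow> (v,w) \<notin> arcs_ends G"
    "\<And>X. \<not> separates (arcs_ends G) (verts G - {v}) X"
proof -
  obtain v where v: "verts C = {v}"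
    using assms(3) unfolding complete_digraph_def by (metis card_1_singletonE)
  have vs: "{v} \<in> sccs_verts" using assms(2) v unfolding sccs_verts_conv by (metis imageI)
  obtain S T where "sccs_verts = {S,T}" "S \<noteq> T"
    using assms(1) card_sccs_verts by (metis card_2_iff)
  then obtain S where S: "sccs_verts = {{v},S}" "S \<noteq> {v}" using vs by auto
  have vG: "v \<in> verts G" using sccs_verts_subsets[OF vs] by simp
  have "\<Union> sccs_verts = verts G"
    using sccs_verts_subsets scc_of_in_sccs_verts in_scc_of_self by blast
  moreover have "{v} \<inter> S = {}" using S by (intro sccs_verts_disjoint) auto
  ultimately have V: "verts G - {v} = S" using S by auto
  have "strongly_connected (G \<restriction> S)"
    using in_verts_sccsD_sccs[of S] S by (auto elim: in_sccsE)
  then have "\<not> separates (arcs_ends G) (verts G - {v}) X" for X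
    using not_separates_strongly_connected unfolding V by blast
  moreover have "(v,w) \<notin> arcs_ends G" for w
  proof
    assume vw: "(v,w) \<in> arcs_ends G"
    then have "w \<in> scc_of v" "v \<in> scc_of v"
      using scc_ofI_reachable' in_scc_of_self[OF vG] by auto
    then have "w = v" using scc_of_in_sccs_verts[OF vG] sccs_verts_disjoint[OF vs] by blast
    then show False using vw adj_not_same by blast
  qed
  ultimately show thesis using that vG by blast
qed

end


section \<open>The graph \<open>K_1 + (K_1 \<oplus> H)\<close>\<close>

text \<open>The adjacency table of this graph: \<open>Inl ()\<close> is isolated, and
  \<open>Inr (Inl ())\<close> is joined to the copy of \<open>H\<close> formed by the vertices
  \<open>Inr (Inr x)\<close>.\<close>

lemma parcs_isolated_plus_cone:
  fixes H :: "'a pair_pre_digraph"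
  defines "K \<equiv> disjoint_union singleton_graph (graph_join singleton_graph H)"
  shows "pverts K = insert (Inl ()) (insert (Inr (Inl ())) (Inr ` Inr ` pverts H))"
    and "(Inl (), z) \<notin> parcs K" and "(z, Inl ()) \<notin> parcs K"
    and "(Inr (Inl ()), Inr (Inl ())) \<notin> parcs K"
    and "(Inr (Inl ()), Inr (Inr x)) \<in> parcs K \<longleftrightarrow> x \<in> pverts H"
    and "(Inr (Inr x), Inr (Inl ())) \<in> parcs K \<longleftrightarrow> x \<in> pverts H"
    and "(Inr (Inr x), Inr (Inr y)) \<in> parcs K \<longleftrightarrow> (x,y) \<in> parcs H"
  unfolding K_def disjoint_union_def graph_join_def singleton_graph_def
  by (auto intro!: map_prod_imageI)

lemma pair_graph_isolated_plus_cone: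
  "pair_graph H \<Longrightarrow>
    pair_graph (disjoint_union singleton_graph (graph_join singleton_graph H))"
  by (intro pair_graph_disjoint_union pair_graph_join pair_graph_singleton)

lemma obstruction_on_isolated_plus_cone:
  fixes H :: "'a pair_pre_digraph"
  defines "K \<equiv> disjoint_union singleton_graph (graph_join singleton_graph H)"
  assumes "pair_graph H" and "k \<ge> 1"
    and obs: "obstruction_on k (parcs H) (pverts H)"
    and mono: "monopolar_on (Suc k) (parcs H) (pverts H)"
  shows "obstruction_on (Suc k) (parcs K) (pverts K)"
proof -
  interpret K: pair_graph K
    unfolding K_def using assms(2) by (rule pair_graph_isolated_plus_cone)
  interpret sym_irrefl "parcs K" using K.sym_irrefl_arcs_ends by simp
  let ?W = "(\<lambda>x. Inr (Inr x)) ` pverts H :: (unit + unit + 'a) set"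
  note arcs = parcs_isolated_plus_cone[where H = H, folded K_def]
  have W: "obstruction_on k (parcs K) ?W" "monopolar_on (Suc k) (parcs K) ?W"
    using obs mono
      obstruction_on_image[of "\<lambda>x. Inr (Inr x)" "pverts H" "parcs K" "parcs H"]
      polar_on_image(2)[of "\<lambda>x. Inr (Inr x)" "pverts H" "parcs K" "parcs H"]
    by (simp_all add: inj_on_def arcs)
  have "obstruction_on (Suc k) (parcs K) (insert (Inl ()) (insert (Inr (Inl ())) ?W))"
    by (rule obstruction_on_insert_isolated_universal[OF assms(3) W]) (auto simp: arcs)
  then show ?thesis by (simp add: arcs image_image)
qed

lemma digraph_iso_isolated_plus_cone:
  fixes G :: "'a pair_pre_digraph"
  assumes "pair_graph G" and V: "pverts G = insert v (insert u W)" "v \<notin> W" "u \<notin> W" "v \<noteq> u"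
    and v: "\<And>w. w \<in> pverts G \<Longrightarrow> (v,w) \<notin> parcs G" and u: "\<And>w. w \<in> W \<Longrightarrow> (u,w) \<in> parcs G"
    and H: "pair_graph H" "pverts H = W" "parcs H = parcs G \<inter> W \<times> W"
  shows "digraph_iso (with_proj G)
    (with_proj (disjoint_union singleton_graph (graph_join singleton_graph H)))"
proof -
  interpret G: pair_graph G by fact
  let ?K = "disjoint_union singleton_graph (graph_join singleton_graph H)"
  interpret K: pair_graph ?K using H(1) by (rule pair_graph_isolated_plus_cone)
  note arcs = parcs_isolated_plus_cone[where H = H]
  define f :: "'a \<Rightarrow> unit + unit + 'a" where
    "f x = (if x = v then Inl () else if x = u then Inr (Inl ()) else Inr (Inr x))" for x
  have fW: "f w = Inr (Inr w)" if "w \<in> W" for w using that V unfolding f_def by auto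
  have fvu: "f v = Inl ()" "f u = Inr (Inl ())" using V unfolding f_def by auto
  have "inj_on f (pverts G)" unfolding inj_on_def f_def by auto
  moreover have "f ` pverts G = pverts ?K" unfolding V arcs H by (simp add: fvu fW image_image)
  moreover have "(f x, f y) \<in> parcs ?K \<longleftrightarrow> (x,y) \<in> parcs G" if "x \<in> pverts G" "y \<in> pverts G" for x y
  proof -
    have v': "(w,v) \<notin> parcs G" if "w \<in> pverts G" for w using that v G.arcs_symmetric by blast
    have u': "(w,u) \<in> parcs G" if "w \<in> W" for w using that u G.arcs_symmetric by blast
    have uu: "(u,u) \<notin> parcs G" using G.no_loops' by blast
    from that show ?thesis
      using v v' u u' uu unfolding V
      by (auto simp: fvu fW arcs H)
  qed
  ultimately show ?thesis
    using G.digraph_iso_with_proj_iff[of ?K] by auto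
qed

theorem theorem7:
  fixes G :: "'a pair_pre_digraph" and k :: nat
  assumes "k \<ge> 2"
    and "pair_graph G"
    and "card (conn_components (with_proj G)) = 2"
    and "\<exists>C \<in> conn_components (with_proj G). complete_digraph 1 C"
  shows "cograph_min_polar_obstruction \<infinity> (enat k) (with_proj G) \<longleftrightarrow>
    (\<exists>H' :: 'a pair_pre_digraph. pair_graph H' \<and>
       digraph_iso (with_proj G)
         (with_proj (disjoint_union singleton_graph (graph_join singleton_graph H'))) \<and>
       \<not> Digraph_Component.connected (with_proj H') \<and>
       cograph_min_polar_obstruction \<infinity> (enat (k - 1)) (with_proj H') \<and>
       polar 1 (enat k) (with_proj H'))"
proof -
  interpret G: pair_graph G by fact
  interpret E: sym_irrefl "parcs G" using G.sym_irrefl_arcs_ends by simp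
  \<comment> \<open>The lemmas on relations pass from a number that is at least 1 to its successor;
    they are applied to \<open>k - 1\<close>, which is where \<open>k \<ge> 2\<close>
    enters.\<close>
  have k: "k - 1 \<ge> 1" "Suc (k - 1) = k" using assms(1) by auto
  have obsG: "cograph_min_polar_obstruction \<infinity> (enat k) (with_proj G) \<longleftrightarrow>
      obstruction_on (Suc (k - 1)) (parcs G) (pverts G)"
    using G.cograph_min_polar_obstruction_iff k(2) by simp
  show ?thesis
  proof
    assume "cograph_min_polar_obstruction \<infinity> (enat k) (with_proj G)"
    then have obs: "obstruction_on (Suc (k - 1)) (parcs G) (pverts G)" using obsG by blast
    obtain v where v: "v \<in> pverts G" "\<And>w. w \<in> pverts G \<Longrightarrow> (v,w) \<notin> parcs G"
      "\<And>X. \<not> separates (parcs G) (pverts G - {v}) X"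
      using G.isolated_vertex_of_components assms(3,4) by metis
    obtain u W X where W: "pverts G = insert v (insert u W)" "v \<notin> W" "u \<notin> W" "v \<noteq> u"
        "\<And>w. w \<in> W \<Longrightarrow> (u,w) \<in> parcs G" "obstruction_on (k - 1) (parcs G) W"
        "monopolar_on (Suc (k - 1)) (parcs G) W" "separates (parcs G) W X"
      using E.obstruction_on_isolatedE[OF G.pair_finite_verts k(1) obs v] by metis
    \<comment> \<open>The witness is the subgraph of \<open>G\<close> induced by \<open>W\<close>,
      so it keeps the vertex type of \<open>G\<close>.\<close>
    define H where "H = \<lparr>pverts = W, parcs = parcs G \<inter> W \<times> W\<rparr>"
    have H: "pverts H = W" "parcs H = parcs G \<inter> W \<times> W" unfolding H_def by simp_all
    have "with_proj H = with_proj G \<restriction> W"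
      unfolding H_def with_proj_def induce_subgraph_def by auto
    then have "graph (with_proj H)"
      using G.graph_induced_subgraph[OF G.induced_induce[of W]] W(1) by auto
    then interpret H: pair_graph H by (rule pair_graphI_graph)
    have "digraph_iso (with_proj G)
        (with_proj (disjoint_union singleton_graph (graph_join singleton_graph H)))"
      using digraph_iso_isolated_plus_cone[OF assms(2) W(1-4) v(2) W(5) H.pair_graph H] by blast
    moreover have "cograph_min_polar_obstruction \<infinity> (enat (k - 1)) (with_proj H)"
      unfolding H.cograph_min_polar_obstruction_iff H
      using W(6) obstruction_on_image[of id W "parcs G \<inter> W \<times> W" "parcs G"] by simp
    moreover have "polar 1 (enat k) (with_proj H)"
      unfolding H.polar_iff H
      using W(7) polar_on_image(2)[of id W "parcs G \<inter> W \<times> W" "parcs G"] unfolding k(2) by simp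
    moreover have "separates (parcs H) (pverts H) X"
      using W(8) unfolding H separates_def by blast
    then have "\<not> Digraph_Component.connected (with_proj H)"
      using H.not_connected_iff unfolding separates_def by auto
    ultimately show "\<exists>H' :: 'a pair_pre_digraph. pair_graph H' \<and>
       digraph_iso (with_proj G)
         (with_proj (disjoint_union singleton_graph (graph_join singleton_graph H'))) \<and>
       \<not> Digraph_Component.connected (with_proj H') \<and>
       cograph_min_polar_obstruction \<infinity> (enat (k - 1)) (with_proj H') \<and>
       polar 1 (enat k) (with_proj H')"
      using H.pair_graph by blast
  next
    assume "\<exists>H' :: 'a pair_pre_digraph. pair_graph H' \<and>
       digraph_iso (with_proj G)
         (with_proj (disjoint_union singleton_graph (graph_join singleton_graph H'))) \<and>
       \<not> Digraph_Component.connected (with_proj H') \<and>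
       cograph_min_polar_obstruction \<infinity> (enat (k - 1)) (with_proj H') \<and>
       polar 1 (enat k) (with_proj H')"
    then obtain H :: "'a pair_pre_digraph" where "pair_graph H"
      and iso: "digraph_iso (with_proj G)
        (with_proj (disjoint_union singleton_graph (graph_join singleton_graph H)))"
      and H: "cograph_min_polar_obstruction \<infinity> (enat (k - 1)) (with_proj H)"
        "polar 1 (enat k) (with_proj H)"
      by blast
    let ?K = "disjoint_union singleton_graph (graph_join singleton_graph H)"
    interpret H: pair_graph H by fact
    interpret K: pair_graph ?K using H.pair_graph by (rule pair_graph_isolated_plus_cone)
    have "obstruction_on (Suc (k - 1)) (parcs ?K) (pverts ?K)"
      using H H.cograph_min_polar_obstruction_iff H.polar_iff(2) k
      by (intro obstruction_on_isolated_plus_cone) auto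
    \<comment> \<open>The isomorphism yields a vertex bijection, along which the obstruction is
      carried back to \<open>G\<close>.\<close>
    moreover obtain f where "inj_on f (pverts G)" "f ` pverts G = pverts ?K"
      "\<And>x y. x \<in> pverts G \<Longrightarrow> y \<in> pverts G \<Longrightarrow> (f x, f y) \<in> parcs ?K \<longleftrightarrow> (x,y) \<in> parcs G"
      using iso G.digraph_iso_with_proj_iff[of ?K] K.pair_wf_digraph by auto
    ultimately show "cograph_min_polar_obstruction \<infinity> (enat k) (with_proj G)"
      using obstruction_on_image[of f "pverts G" "parcs ?K" "parcs G"] obsG by simp
  qed
qed

end
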